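(* Let $G$ be a finite connected simple graph with at most one cycle, with rooted trees $T_1,\dots,T_m$ and levels as in the context. Let $z_0\in T_i$ be a leaf of $G$ of the highest level among all leaves of $G$ in $T_i$, and assume $\operatorname{level}(z_0)\ge 2$. Let $y_0$ be the unique neighbor of $z_0$, and write $N(y_0)=\{z_0,z_1,\dots,z_s\}\cup\{x_0\}$, where $z_1,\dots,z_s$ ($s\ge 0$) are leaves of $G$ having the same level as $z_0$ and $x_0$ is the unique neighbor of $y_0$ of smaller level. Put $G_{z_0,1}=G\setminus\{z_0,\dots,z_s\}$, $G_{z_0,2}=G\setminus N[y_0]$, $G_{z_0,3}=G\setminus N[\{y_0,x_0\}]$. Then $$\operatorname{reg}(I_3(G))=\begin{cases}\max\{\operatorname{reg}(I_3(G_{z_0,1})),\ \operatorname{reg}(I_3(G_{z_0,2}))+2\}, & \text{if } s\ge 1,\\ \max\{\operatorname{reg}(I_3(G_{z_0,1})),\ \operatorname{reg}(I_3(G_{z_0,3}))+2\}, & \text{if } s=0.\end{cases}$$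
   Context: $S=\mathrm{k}[x\mid x\in V(G)]$ is a standard graded polynomial ring over a field $\mathrm{k}$. A $3$-path of a graph $H$ is a sequence $x,y,z$ of distinct vertices with $\{x,y\},\{y,z\}\in E(H)$; $I_3(H)$ is the ideal generated by the monomials $xyz$ over all $3$-paths $x,y,z$ of $H$. All $3$-path ideals of induced subgraphs are viewed as ideals of $S$. $\operatorname{reg}(M)=\sup\{j-i\mid \operatorname{Tor}^S_i(\mathrm{k},M)_j\neq 0\}$, with the convention $\operatorname{reg}(0)=1$ for the zero ideal (so that $\operatorname{reg}(I)=\operatorname{reg}(S/I)+1$ always holds). $N(x)$ is the set of neighbors of $x$ in $G$, $N[x]=N(x)\cup\{x\}$, $N[U]=\bigcup_{x\in U}N[x]$; $G\setminus U$ is the induced subgraph on $V(G)\setminus U$. A leaf is a vertex with exactly one neighbor. If $G$ has a cycle, let it be on vertices $v_1,\dots,v_m$, and let $T_i$ be the tree attached to $v_i$, i.e. the connected component containing $v_i$ of the graph obtained from $G$ by deleting the edges of the cycle, rooted at $v_i$. If $G$ is a tree, $m=1$, $v_1$ is any chosen vertex, and $T_1=G$ rooted at $v_1$. The level of $y\in T_i$ is the length of the unique path in $T_i$ from $v_i$ to $y$. *)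

theory Defs
  imports Complex_Main "HOL-Library.Poly_Mapping" "HOL-Library.Extended_Real"
begin

section \<open>Finite simple graphs\<close>

text \<open>A graph is a pair of a vertex set and a set of two-element edges.\<close>

type_synonym 'v graph = "'v set \<times> 'v set set"

abbreviation verts :: "'v graph \<Rightarrow> 'v set" where "verts \<equiv> fst"
abbreviation edges :: "'v graph \<Rightarrow> 'v set set" where "edges \<equiv> snd"

definition simple_graph :: "'v graph \<Rightarrow> bool" where
  "simple_graph G \<longleftrightarrow> finite (verts G) \<and> (\<forall>e\<in>edges G. e \<subseteq> verts G \<and> card e = 2)"

definition adjacent :: "'v graph \<Rightarrow> 'v \<Rightarrow> 'v \<Rightarrow> bool" where
  "adjacent G x y \<longleftrightarrow> {x, y} \<in> edges G"

definition nbhd :: "'v graph \<Rightarrow> 'v \<Rightarrow> 'v set" where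
  "nbhd G x = {y. adjacent G x y}"

definition closed_nbhd :: "'v graph \<Rightarrow> 'v set \<Rightarrow> 'v set" where
  "closed_nbhd G U = (\<Union>x\<in>U. insert x (nbhd G x))"

definition induced :: "'v graph \<Rightarrow> 'v set \<Rightarrow> 'v graph" where
  "induced G W = (verts G \<inter> W, {e \<in> edges G. e \<subseteq> W})"

definition delete_verts :: "'v graph \<Rightarrow> 'v set \<Rightarrow> 'v graph" where
  "delete_verts G U = induced G (verts G - U)"

definition leaf :: "'v graph \<Rightarrow> 'v \<Rightarrow> bool" where
  "leaf G x \<longleftrightarrow> x \<in> verts G \<and> card (nbhd G x) = 1"

text \<open>Paths are given by their list of vertices, which are pairwise distinct.\<close>

definition is_path :: "'v graph \<Rightarrow> 'v \<Rightarrow> 'v list \<Rightarrow> 'v \<Rightarrow> bool" where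
  "is_path G u p w \<longleftrightarrow> p \<noteq> [] \<and> hd p = u \<and> last p = w \<and> distinct p \<and>
     set p \<subseteq> verts G \<and> successively (adjacent G) p"

definition connected_graph :: "'v graph \<Rightarrow> bool" where
  "connected_graph G \<longleftrightarrow> verts G \<noteq> {} \<and> (\<forall>u\<in>verts G. \<forall>w\<in>verts G. \<exists>p. is_path G u p w)"

definition component :: "'v graph \<Rightarrow> 'v \<Rightarrow> 'v graph" where
  "component G v = induced G {w. \<exists>p. is_path G v p w}"

definition is_cycle :: "'v graph \<Rightarrow> 'v list \<Rightarrow> bool" where
  "is_cycle G vs \<longleftrightarrow> 3 \<le> length vs \<and> distinct vs \<and> set vs \<subseteq> verts G \<and>
     successively (adjacent G) vs \<and> adjacent G (last vs) (hd vs)"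

definition cycle_edges :: "'v list \<Rightarrow> 'v set set" where
  "cycle_edges vs = {{vs ! i, vs ! (Suc i mod length vs)} | i. i < length vs}"

text \<open>Different vertex lists can describe the same cycle (rotations and reversals); a cycle as
  a subgraph is determined by its edge set.\<close>

definition at_most_one_cycle :: "'v graph \<Rightarrow> bool" where
  "at_most_one_cycle G \<longleftrightarrow>
     (\<forall>vs ws. is_cycle G vs \<longrightarrow> is_cycle G ws \<longrightarrow> cycle_edges vs = cycle_edges ws)"

text \<open>The list of roots \<open>v\<^sub>1, \<dots>, v\<^sub>m\<close>: the vertices of the cycle of \<open>G\<close> in cyclic order, or an
  arbitrary single vertex if \<open>G\<close> has no cycle.\<close>

definition root_list :: "'v graph \<Rightarrow> 'v list \<Rightarrow> bool" where
  "root_list G vs \<longleftrightarrow>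
     is_cycle G vs \<or> ((\<nexists>ws. is_cycle G ws) \<and> (\<exists>v\<in>verts G. vs = [v]))"

text \<open>For \<open>vs = [v]\<close> the set \<open>cycle_edges vs\<close> is \<open>{{v}}\<close>, which contains no edge of a simple graph;
  the tree attached to \<open>v\<close> is then the component of \<open>v\<close> in \<open>G\<close>.\<close>

definition attached_tree :: "'v graph \<Rightarrow> 'v list \<Rightarrow> 'v \<Rightarrow> 'v graph" where
  "attached_tree G vs v = component (verts G, edges G - cycle_edges vs) v"

definition level :: "'v graph \<Rightarrow> 'v \<Rightarrow> 'v \<Rightarrow> nat" where
  "level T r y = length (THE p. is_path T r p y) - 1"

section \<open>The polynomial ring and 3-path ideals\<close>

text \<open>The polynomial ring over \<open>'k\<close> whose variables are the elements of \<open>'v\<close>.\<close>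

type_synonym ('v, 'k) mpoly = "('v \<Rightarrow>\<^sub>0 nat) \<Rightarrow>\<^sub>0 'k"

definition Var :: "'v \<Rightarrow> ('v, 'k::field) mpoly" where
  "Var x = Poly_Mapping.single (Poly_Mapping.single x 1) 1"

definition homogeneous :: "int \<Rightarrow> ('v::finite, 'k::field) mpoly \<Rightarrow> bool" where
  "homogeneous d p \<longleftrightarrow>
     (\<forall>m\<in>Poly_Mapping.keys p. int (\<Sum>x\<in>UNIV. Poly_Mapping.lookup m x) = d)"

definition ideal_generated :: "('v, 'k::field) mpoly set \<Rightarrow> ('v, 'k) mpoly set" where
  "ideal_generated A = module.span (*) A"

definition is_3path :: "'v graph \<Rightarrow> 'v \<Rightarrow> 'v \<Rightarrow> 'v \<Rightarrow> bool" where
  "is_3path H x y z \<longleftrightarrow> distinct [x, y, z] \<and> {x, y, z} \<subseteq> verts H \<and>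
     adjacent H x y \<and> adjacent H y z"

definition path_ideal3 :: "'v graph \<Rightarrow> ('v, 'k::field) mpoly set" where
  "path_ideal3 H = ideal_generated {Var x * Var y * Var z | x y z. is_3path H x y z}"

section \<open>Graded Tor and Castelnuovo--Mumford regularity\<close>

text \<open>A complex \<open>\<dots> \<rightarrow> F\<^sub>2 \<rightarrow> F\<^sub>1 \<rightarrow> F\<^sub>0\<close> of graded free modules
  \<open>F\<^sub>i = \<Oplus>\<^bsub>a < rk i\<^esub> S(- shift i a)\<close> of finite rank over the polynomial ring \<open>S\<close>;
  \<open>mat i a b\<close> is the coefficient of the basis element \<open>e\<^sub>b\<close> of \<open>F\<^sub>i\<close>
  in the image of the basis element \<open>e\<^sub>a\<close> of \<open>F\<^bsub>i+1\<^esub>\<close>.\<close>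

record (overloaded) ('v, 'k) free_complex =
  rk :: "nat \<Rightarrow> nat"
  shift :: "nat \<Rightarrow> nat \<Rightarrow> int"
  mat :: "nat \<Rightarrow> nat \<Rightarrow> nat \<Rightarrow> ('v, 'k) mpoly"

text \<open>For a homogeneous ideal (more generally, graded submodule) \<open>M\<close> of \<open>S\<close> the tensor product
  \<open>F\<^sub>i \<otimes> M\<close> is \<open>\<Oplus>\<^bsub>a < rk i\<^esub> M(- shift i a)\<close>, and the differential is again given by \<open>mat\<close>.
  \<open>chains F M i j\<close> is the homogeneous component of degree \<open>j\<close> of \<open>F\<^sub>i \<otimes> M\<close>; its elements are
  functions which vanish outside \<open>{..<rk i}\<close>. Taking \<open>M = UNIV\<close> gives \<open>F\<^sub>i\<close> itself.\<close>

definition chains ::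
  "('v::finite, 'k::field) free_complex \<Rightarrow> ('v, 'k) mpoly set \<Rightarrow> nat \<Rightarrow> int
     \<Rightarrow> (nat \<Rightarrow> ('v, 'k) mpoly) set" where
  "chains F M i j =
     {u. (\<forall>a<rk F i. u a \<in> M \<and> homogeneous (j - shift F i a) (u a)) \<and> (\<forall>a\<ge>rk F i. u a = 0)}"

definition bd ::
  "('v, 'k::field) free_complex \<Rightarrow> nat \<Rightarrow> (nat \<Rightarrow> ('v, 'k) mpoly) \<Rightarrow> nat \<Rightarrow> ('v, 'k) mpoly" where
  "bd F i u = (case i of
       0 \<Rightarrow> (\<lambda>_. 0)
     | Suc n \<Rightarrow> (\<lambda>b. if b < rk F n then (\<Sum>a<rk F (Suc n). u a * mat F n a b) else 0))"

definition cycles ::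
  "('v::finite, 'k::field) free_complex \<Rightarrow> ('v, 'k) mpoly set \<Rightarrow> nat \<Rightarrow> int
     \<Rightarrow> (nat \<Rightarrow> ('v, 'k) mpoly) set" where
  "cycles F M i j = {u \<in> chains F M i j. bd F i u = (\<lambda>_. 0)}"

definition boundaries ::
  "('v::finite, 'k::field) free_complex \<Rightarrow> ('v, 'k) mpoly set \<Rightarrow> nat \<Rightarrow> int
     \<Rightarrow> (nat \<Rightarrow> ('v, 'k) mpoly) set" where
  "boundaries F M i j = bd F (Suc i) ` chains F M (Suc i) j"

text \<open>The map \<open>F\<^sub>0 \<rightarrow> k\<close> sending \<open>e\<^sub>a\<close> to \<open>\<epsilon> a\<close>; \<open>S\<close> acts on \<open>k\<close> through the constant coefficient.\<close>

definition augmentation ::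
  "('v, 'k::field) free_complex \<Rightarrow> (nat \<Rightarrow> 'k) \<Rightarrow> (nat \<Rightarrow> ('v, 'k) mpoly) \<Rightarrow> 'k" where
  "augmentation F \<epsilon> u = (\<Sum>a<rk F 0. Poly_Mapping.lookup (u a) 0 * \<epsilon> a)"

text \<open>\<open>F\<close> is a graded free resolution of the residue field \<open>k\<close> (in degree 0): the differentials
  and the augmentation preserve degrees, and \<open>\<dots> \<rightarrow> F\<^sub>1 \<rightarrow> F\<^sub>0 \<rightarrow> k \<rightarrow> 0\<close> is exact. As all maps are
  graded, exactness is stated in each degree separately.\<close>

definition graded_free_resolution_of_k :: "('v::finite, 'k::field) free_complex \<Rightarrow> bool" where
  "graded_free_resolution_of_k F \<longleftrightarrow>
     (\<forall>i. \<forall>a<rk F (Suc i). \<forall>b<rk F i. homogeneous (shift F (Suc i) a - shift F i b) (mat F i a b)) \<and>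
     (\<forall>i j. cycles F UNIV (Suc i) j = boundaries F UNIV (Suc i) j) \<and>
     (\<exists>\<epsilon>. (\<forall>a<rk F 0. \<epsilon> a \<noteq> 0 \<longrightarrow> shift F 0 a = 0) \<and>
          (\<forall>j. {u \<in> chains F UNIV 0 j. augmentation F \<epsilon> u = 0} = boundaries F UNIV 0 j) \<and>
          augmentation F \<epsilon> ` chains F UNIV 0 0 = UNIV)"

text \<open>\<open>Tor\<^sub>i(k, M)\<^sub>j \<noteq> 0\<close>: the homology \<open>cycles / boundaries\<close> of \<open>F \<otimes> M\<close> at \<open>(i, j)\<close>, for \<open>F\<close> a graded
  free resolution of \<open>k\<close>, is nonzero. Up to isomorphism it does not depend on \<open>F\<close>.\<close>

definition Tor_nonzero :: "('v::finite, 'k::field) mpoly set \<Rightarrow> nat \<Rightarrow> int \<Rightarrow> bool" where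
  "Tor_nonzero M i j \<longleftrightarrow>
     (\<exists>F. graded_free_resolution_of_k F \<and> cycles F M i j \<noteq> boundaries F M i j)"

text \<open>Note the convention for the zero ideal.\<close>

definition reg :: "('v::finite, 'k::field) mpoly set \<Rightarrow> ereal" where
  "reg I = (if I = {0} then 1 else Sup {ereal (of_int (j - int i)) | i j. Tor_nonzero I i j})"

end

theory Submission
  imports Defs "HOL-Library.Function_Algebras"
begin

text \<open>
  All ideals that occur are squarefree monomial. For such an ideal \<open>I\<close> and a squarefree monomial \<open>f\<close>
  of degree \<open>d\<close>, the Mayer--Vietoris sequence of \<open>I\<close> and \<open>(f)\<close>, whose intersection is
  \<open>f (I : f)\<close>, gives \<open>reg I \<le> max (reg (I + f)) (reg (I : f) + d)\<close> and
  \<open>reg (I + f) \<le> max (reg I) (reg (I : f) + d - 1)\<close>. For \<open>s \<ge> 1\<close> the upper bound follows by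
  splitting with \<open>y\<^sub>0\<close> and then with \<open>x\<^sub>0\<close>. For \<open>s = 0\<close> split with \<open>f = x\<^sub>0 y\<^sub>0\<close>; then
  \<open>I\<^sub>3(G) + f = I\<^sub>3(G \<setminus> z\<^sub>0) + f\<close>, which is bounded by the second inequality.

  The lower bounds come from restriction to induced subgraphs and from adding a 3-path that is
  disjoint from the rest of the graph. Both rest on the fact that multiplication by a monomial of
  positive degree is null-homotopic on a resolution of \<open>k\<close>, hence zero on \<open>Tor\<close>. Every step works
  with one fixed resolution, so the independence of \<open>Tor\<close> of the resolution is not needed, only
  the existence of one: an iterated mapping cone over the variables, i.e. the Koszul complex.
\<close>

section \<open>Squarefree monomial ideals\<close>

definition indic :: "'v set \<Rightarrow> ('v \<Rightarrow>\<^sub>0 nat)" where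
  "indic T = (\<Sum>x\<in>T. Poly_Mapping.single x 1)"

definition sqmon :: "'v set \<Rightarrow> ('v::finite, 'k::field) mpoly" where
  "sqmon T = Poly_Mapping.single (indic T) 1"

text \<open>The ideal is described by the supports of its monomials instead of as a span, so
  membership is checked monomial by monomial. \<open>A\<close> may contain redundant generators;
  agreement with the generated ideal is \<open>ideal_generated_sqmon\<close>.\<close>

definition sqf :: "'v set set \<Rightarrow> ('v::finite, 'k::field) mpoly set" where
  "sqf A = {p. \<forall>m\<in>Poly_Mapping.keys p. \<exists>S\<in>A. S \<subseteq> Poly_Mapping.keys m}"

text \<open>Generators of the ideal quotient by the monomial of \<open>T\<close>, as justified by
  \<open>sqmon_mult_mem_sqf_iff\<close>.\<close>

definition colon :: "'v set set \<Rightarrow> 'v set \<Rightarrow> 'v set set" where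
  "colon A T = (\<lambda>S. S - T) ` A"

definition filter_poly :: "(('v \<Rightarrow>\<^sub>0 nat) \<Rightarrow> bool) \<Rightarrow> ('v, 'k::field) mpoly \<Rightarrow> ('v, 'k) mpoly" where
  "filter_poly P p = Poly_Mapping.mapp (\<lambda>m c. c when P m) p"

text \<open>Division by the monomial of \<open>T\<close>; terms not divisible by it are
  dropped.\<close>

definition shift_down :: "'v set \<Rightarrow> ('v::finite, 'k::field) mpoly \<Rightarrow> ('v, 'k) mpoly" where
  "shift_down T p = Poly_Mapping.map_key (\<lambda>m. (indic T) + m) p"

section \<open>Supports of monomials and membership in squarefree monomial ideals\<close>

lemma lookup_indic:
  fixes T :: "'v::finite set"
  shows "Poly_Mapping.lookup (indic T) y = (if y \<in> T then 1 else 0)"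
  by (simp add: indic_def lookup_sum lookup_single when_def)

lemma keys_add_nat: "Poly_Mapping.keys (m + n) = Poly_Mapping.keys m \<union> Poly_Mapping.keys (n :: 'v \<Rightarrow>\<^sub>0 nat)"
  by (auto simp: in_keys_iff lookup_add)

lemma keys_indic:
  fixes T :: "'v::finite set"
  shows "Poly_Mapping.keys (indic T) = T"
  by (auto simp: in_keys_iff lookup_indic split: if_splits)

lemma inj_shift_nat: "inj (\<lambda>m. t + (m :: 'v \<Rightarrow>\<^sub>0 nat))"
  by (rule injI) simp

lemma lookup_single_mult:
  "Poly_Mapping.lookup (Poly_Mapping.single t c * p) (t + m) = c * Poly_Mapping.lookup (p :: ('v, 'k::field) mpoly) m"
proof -
  have "(\<Sum>q. Poly_Mapping.lookup p q when t + m = t + q) = Poly_Mapping.lookup p m"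
    by simp
  then show ?thesis
    by (simp add: lookup_mult lookup_single when_mult)
qed

lemma keys_single_mult:
  "Poly_Mapping.keys (Poly_Mapping.single t 1 * p) = (+) t ` Poly_Mapping.keys (p :: ('v, 'k::field) mpoly)"
proof
  show "Poly_Mapping.keys (Poly_Mapping.single t 1 * p) \<subseteq> (+) t ` Poly_Mapping.keys p"
    using keys_mult[of "Poly_Mapping.single t 1" p] by (auto split: if_splits)
  show "(+) t ` Poly_Mapping.keys p \<subseteq> Poly_Mapping.keys (Poly_Mapping.single t 1 * p)"
    by (auto simp: in_keys_iff lookup_single_mult)
qed

lemma keys_sqmon_mult:
  "Poly_Mapping.keys (sqmon T * p) = (+) (indic T) ` Poly_Mapping.keys p"
  by (simp add: sqmon_def keys_single_mult)

text \<open>Multiplication by the monomial of \<open>T\<close> adds \<open>T\<close> to every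
  support \<open>K\<close>, and \<open>S\<close> lies in the union of \<open>T\<close> and
  \<open>K\<close> exactly when \<open>S - T\<close> lies in \<open>K\<close>.\<close>

lemma sqmon_mult_mem_sqf_iff: "sqmon T * p \<in> sqf A \<longleftrightarrow> p \<in> sqf (colon A T)"
proof -
  have "(S \<subseteq> T \<union> K) = (S - T \<subseteq> K)" for S K by auto
  then show ?thesis
    unfolding sqf_def colon_def by (simp add: keys_sqmon_mult keys_add_nat keys_indic)
qed

lemma sqf_0: "0 \<in> sqf A" by (simp add: sqf_def)

lemma sqf_add: "p \<in> sqf A \<Longrightarrow> q \<in> sqf A \<Longrightarrow> p + q \<in> sqf A"
  using keys_add[of p q] by (auto simp: sqf_def)

lemma sqf_uminus: "p \<in> sqf A \<Longrightarrow> - p \<in> sqf A"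
  by (simp add: sqf_def)

lemma sqf_diff: "p \<in> sqf A \<Longrightarrow> q \<in> sqf A \<Longrightarrow> p - q \<in> sqf A"
  using sqf_add[of p A "- q"] by (simp add: sqf_uminus)

lemma sqf_mult: assumes "q \<in> sqf A" shows "p * q \<in> sqf A"
  unfolding sqf_def
proof (intro CollectI ballI)
  fix m assume "m \<in> Poly_Mapping.keys (p * q)"
  then obtain a b where ab: "m = a + b" "b \<in> Poly_Mapping.keys q"
    using keys_mult[of p q] by auto
  then obtain S where "S \<in> A" "S \<subseteq> Poly_Mapping.keys b"
    using assms by (auto simp: sqf_def)
  then show "\<exists>S\<in>A. S \<subseteq> Poly_Mapping.keys m"
    using ab by (auto simp: keys_add_nat)
qed

lemma sqf_sum: "(\<And>i. i \<in> I \<Longrightarrow> f i \<in> sqf A) \<Longrightarrow> sum f I \<in> sqf A"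
  by (induction I rule: infinite_finite_induct) (auto simp: sqf_0 sqf_add)

lemma sqf_subset:
  assumes "\<And>S. S \<in> A \<Longrightarrow> \<exists>S'\<in>B. S' \<subseteq> S"
  shows "sqf A \<subseteq> sqf B"
proof
  fix p assume p: "p \<in> sqf A"
  show "p \<in> sqf B"
    unfolding sqf_def
  proof (intro CollectI ballI)
    fix m assume "m \<in> Poly_Mapping.keys p"
    then obtain S where S: "S \<in> A" "S \<subseteq> Poly_Mapping.keys m"
      using p unfolding sqf_def by blast
    obtain S' where "S' \<in> B" "S' \<subseteq> S"
      using assms[OF S(1)] by blast
    then show "\<exists>S\<in>B. S \<subseteq> Poly_Mapping.keys m"
      using S(2) by blast
  qed
qed

text \<open>Only the inclusion-minimal members of a generating family matter, so redundant
  generators can be added or removed.\<close>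

lemma sqf_cong:
  assumes "\<And>S. S \<in> A \<Longrightarrow> \<exists>S'\<in>B. S' \<subseteq> S" and "\<And>S. S \<in> B \<Longrightarrow> \<exists>S'\<in>A. S' \<subseteq> S"
  shows "sqf A = sqf B"
  using sqf_subset[of A B, OF assms(1)] sqf_subset[of B A, OF assms(2)] by (rule equalityI)

lemma sqf_top: "sqf {{}} = UNIV"
  by (simp add: sqf_def)

lemma sqf_empty: "sqf {} = {0}"
  by (auto simp: sqf_def)

lemma sqmon_in_sqf: "T \<in> A \<Longrightarrow> sqmon T \<in> sqf A"
  by (auto simp: sqf_def sqmon_def keys_indic)

lemma sqmon_nonzero: "sqmon T \<noteq> (0 :: ('v::finite, 'k::field) mpoly)"
proof
  assume "sqmon T = (0 :: ('v::finite, 'k::field) mpoly)"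
  then have "Poly_Mapping.keys (sqmon T :: ('v, 'k) mpoly) = {}"
    by (simp only: keys_zero)
  then show False by (simp add: sqmon_def)
qed

lemma sqf_eq_zero_iff: "(sqf A :: ('v::finite, 'k::field) mpoly set) = {0} \<longleftrightarrow> A = {}"
proof
  assume *: "(sqf A :: ('v, 'k) mpoly set) = {0}"
  show "A = {}"
  proof (rule ccontr)
    assume "A \<noteq> {}"
    then obtain T where "T \<in> A" by blast
    then have "(sqmon T :: ('v, 'k) mpoly) \<in> {0}"
      unfolding *[symmetric] by (rule sqmon_in_sqf)
    then show False using sqmon_nonzero by blast
  qed
qed (simp add: sqf_empty)

text \<open>The monomial 1 has empty support, so it occurs only if the empty set is a generator; a
  proper monomial ideal lies in the maximal ideal of the variables.\<close>

lemma lookup_zero_sqf: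
  fixes p :: "('v::finite, 'k::field) mpoly"
  shows "{} \<notin> A \<Longrightarrow> p \<in> sqf A \<Longrightarrow> Poly_Mapping.lookup p 0 = 0"
proof (rule ccontr)
  assume A: "{} \<notin> A" "p \<in> sqf A" and "Poly_Mapping.lookup p 0 \<noteq> 0"
  then have "0 \<in> Poly_Mapping.keys p"
    by (simp add: in_keys_iff)
  then obtain S where "S \<in> A" "S \<subseteq> Poly_Mapping.keys (0 :: 'v \<Rightarrow>\<^sub>0 nat)"
    using A(2) unfolding sqf_def by blast
  then show False using A(1) by simp
qed

lemma keys_filter_poly: "Poly_Mapping.keys (filter_poly P p) = {m \<in> Poly_Mapping.keys p. P m}"
  by (auto simp: filter_poly_def in_keys_iff lookup_mapp when_def split: if_splits)

lemma lookup_filter_poly: "Poly_Mapping.lookup (filter_poly P p) m = (if P m then Poly_Mapping.lookup p m else 0)"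
  by (auto simp: filter_poly_def in_keys_iff lookup_mapp when_def)

lemma sqmon_mult_shift_down:
  assumes "\<And>m. m \<in> Poly_Mapping.keys p \<Longrightarrow> T \<subseteq> Poly_Mapping.keys m"
  shows "sqmon T * shift_down T p = p"
proof (rule poly_mapping_eqI)
  fix m
  let ?t = "indic T"
  show "Poly_Mapping.lookup (sqmon T * shift_down T p) m = Poly_Mapping.lookup p m"
  proof (cases "T \<subseteq> Poly_Mapping.keys m")
    case True
    have "m = ?t + (m - ?t)"
      using True by (intro poly_mapping_eqI)
        (auto simp: lookup_add lookup_minus lookup_indic in_keys_iff Suc_leI subset_iff)
    then obtain n where n: "m = ?t + n" by blast
    have "Poly_Mapping.lookup (shift_down T p) n = Poly_Mapping.lookup p (?t + n)"
      unfolding shift_down_def by (subst map_key.rep_eq) (simp_all add: inj_shift_nat)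
    then show ?thesis
      unfolding n sqmon_def lookup_single_mult by simp
  next
    case False
    then have "m \<notin> Poly_Mapping.keys p" "m \<notin> Poly_Mapping.keys (sqmon T * shift_down T p)"
      using assms by (auto simp: keys_sqmon_mult keys_add_nat keys_indic)
    then show ?thesis by (simp add: in_keys_iff)
  qed
qed

section \<open>Total degree and homogeneous polynomials\<close>

definition mdeg :: "('v::finite \<Rightarrow>\<^sub>0 nat) \<Rightarrow> nat" where
  "mdeg m = (\<Sum>x\<in>UNIV. Poly_Mapping.lookup m x)"

lemma homogeneous_iff: "homogeneous d p \<longleftrightarrow> (\<forall>m\<in>Poly_Mapping.keys p. int (mdeg m) = d)"
  by (simp add: homogeneous_def mdeg_def)

lemma mdeg_add: "mdeg (m + n) = mdeg m + mdeg n"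
  by (simp add: mdeg_def lookup_add sum.distrib)

lemma mdeg_indic: "mdeg (indic T) = card T"
  by (simp add: mdeg_def lookup_indic flip: sum.inter_filter)

lemma homogeneous_0: "homogeneous d 0" by (simp add: homogeneous_iff)

lemma homogeneous_1: "homogeneous 0 1" by (simp add: homogeneous_iff mdeg_def)

lemma homogeneous_add: "homogeneous d p \<Longrightarrow> homogeneous d q \<Longrightarrow> homogeneous d (p + q)"
  using keys_add[of p q] by (auto simp: homogeneous_iff)

lemma homogeneous_uminus: "homogeneous d p \<Longrightarrow> homogeneous d (- p)"
  by (simp add: homogeneous_iff)

lemma homogeneous_diff: "homogeneous d p \<Longrightarrow> homogeneous d q \<Longrightarrow> homogeneous d (p - q)"
  using homogeneous_add[of d p "- q"] by (simp add: homogeneous_uminus)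

lemma homogeneous_sum: "(\<And>i. i \<in> I \<Longrightarrow> homogeneous d (f i)) \<Longrightarrow> homogeneous d (sum f I)"
  by (induction I rule: infinite_finite_induct) (auto simp: homogeneous_0 homogeneous_add)

lemma homogeneous_mult:
  assumes "homogeneous d p" "homogeneous e q" shows "homogeneous (d + e) (p * q)"
  unfolding homogeneous_iff
proof
  fix m assume "m \<in> Poly_Mapping.keys (p * q)"
  then obtain a b where "m = a + b" "a \<in> Poly_Mapping.keys p" "b \<in> Poly_Mapping.keys q"
    using keys_mult[of p q] by auto
  then show "int (mdeg m) = d + e"
    using assms by (auto simp: homogeneous_iff mdeg_add)
qed

lemma homogeneous_sqmon: "homogeneous (int (card T)) (sqmon T)"
  by (simp add: homogeneous_iff sqmon_def mdeg_indic)

lemma homogeneous_sqmon_mult_iff: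
  "homogeneous d (sqmon T * p) \<longleftrightarrow> homogeneous (d - int (card T)) p"
  by (simp add: homogeneous_iff keys_sqmon_mult mdeg_add mdeg_indic eq_diff_eq add.commute)

lemma homogeneous_lookup_0: "homogeneous d p \<Longrightarrow> d \<noteq> 0 \<Longrightarrow> Poly_Mapping.lookup p 0 = 0"
  by (force simp: homogeneous_iff in_keys_iff mdeg_def)

text \<open>Terms divisible by a generator from \<open>A\<close> form \<open>q\<close>; all
  remaining terms must be divisible by the monomial of \<open>T\<close>. Splitting by terms
  preserves homogeneity.\<close>

lemma sqf_insert_split:
  fixes p :: "('v::finite, 'k::field) mpoly"
  assumes "p \<in> sqf (insert T A)" and "homogeneous d p"
  obtains q r where "p = q + sqmon T * r" "q \<in> sqf A" "homogeneous d q"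
    "homogeneous (d - int (card T)) r"
proof -
  define P where "P = (\<lambda>m :: 'v \<Rightarrow>\<^sub>0 nat. \<exists>S\<in>A. S \<subseteq> Poly_Mapping.keys m)"
  define q q' r where "q = filter_poly P p" and "q' = filter_poly (\<lambda>m. \<not> P m) p"
    and "r = shift_down T q'"
  have r: "sqmon T * r = q'"
    unfolding r_def
    by (rule sqmon_mult_shift_down) (use assms(1) in \<open>auto simp: q'_def keys_filter_poly P_def sqf_def\<close>)
  have "p = q + q'"
    by (rule poly_mapping_eqI) (simp add: q_def q'_def lookup_add lookup_filter_poly)
  moreover have "q \<in> sqf A"
    by (simp add: q_def sqf_def keys_filter_poly P_def)
  moreover have "homogeneous d q" "homogeneous d q'"
    using assms(2) by (auto simp: q_def q'_def homogeneous_iff keys_filter_poly)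
  ultimately show ?thesis
    using that r by (metis homogeneous_sqmon_mult_iff)
qed

text \<open>A polynomial is the sum of its terms, and each term of a member of \<open>sqf A\<close>
  is a multiple of one generator.\<close>

lemma ideal_generated_sqmon:
  "ideal_generated (sqmon ` A) = (sqf A :: ('v::finite, 'k::field) mpoly set)"
proof -
  interpret M: module "(*) :: ('v, 'k) mpoly \<Rightarrow> _ \<Rightarrow> _"
    by unfold_locales (simp_all add: algebra_simps)
  have 1: "ideal_generated (sqmon ` A) \<subseteq> (sqf A :: ('v, 'k) mpoly set)"
    unfolding ideal_generated_def
    by (rule M.span_minimal)
      (auto simp: M.subspace_def sqmon_in_sqf sqf_0 sqf_add sqf_mult)
  have 2: "p \<in> ideal_generated (sqmon ` A)" if p: "p \<in> sqf A" for p :: "('v, 'k) mpoly"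
  proof -
    have eq: "p = (\<Sum>m\<in>Poly_Mapping.keys p. Poly_Mapping.single m (Poly_Mapping.lookup p m))"
      by (intro poly_mapping_eqI)
        (simp add: lookup_sum lookup_single when_def in_keys_iff)
    have "Poly_Mapping.single m c \<in> M.span (sqmon ` A)" if m: "m \<in> Poly_Mapping.keys p" for m c
    proof -
      obtain S where S: "S \<in> A" "S \<subseteq> Poly_Mapping.keys m"
        using p m by (auto simp: sqf_def)
      have "Poly_Mapping.single m c = sqmon S * shift_down S (Poly_Mapping.single m c)"
        by (rule sqmon_mult_shift_down[symmetric]) (use S in \<open>auto split: if_splits\<close>)
      also have "\<dots> = shift_down S (Poly_Mapping.single m c) * sqmon S"
        by (simp add: mult.commute)
      also have "\<dots> \<in> M.span (sqmon ` A)"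
        using S by (intro M.span_scale M.span_base) auto
      finally show ?thesis .
    qed
    then show ?thesis
      unfolding ideal_generated_def by (subst eq) (rule M.span_sum)
  qed
  from 1 2 show ?thesis by blast
qed

definition path_sets :: "'v graph \<Rightarrow> 'v set set" where
  "path_sets H = {{x, y, z} | x y z. is_3path H x y z}"

text \<open>The three vertices of a 3-path are distinct, so its generator is squarefree and
  determined by the vertex set.\<close>

lemma path_ideal3_eq: "path_ideal3 H = (sqf (path_sets H) :: ('v::finite, 'k::field) mpoly set)"
proof -
  have *: "Var x * Var y * Var z = (sqmon {x, y, z} :: ('v, 'k) mpoly)" if "is_3path H x y z" for x y z
    using that by (simp add: is_3path_def Var_def sqmon_def indic_def mult_single add.assoc)
  then have "{Var x * Var y * Var z | x y z. is_3path H x y z} = (sqmon ` path_sets H :: ('v, 'k) mpoly set)"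
    unfolding path_sets_def image_Collect by (intro Collect_cong) (metis *)
  then show ?thesis
    unfolding path_ideal3_def by (simp only: ideal_generated_sqmon)
qed

section \<open>Chains with coefficients in squarefree monomial ideals\<close>

definition smul :: "('v, 'k::field) mpoly \<Rightarrow> (nat \<Rightarrow> ('v, 'k) mpoly) \<Rightarrow> nat \<Rightarrow> ('v, 'k) mpoly" where
  "smul p u = (\<lambda>a. p * u a)"

definition basis_vec :: "nat \<Rightarrow> nat \<Rightarrow> ('v, 'k::field) mpoly" where
  "basis_vec a = (\<lambda>b. if b = a then 1 else 0)"

text \<open>The linear map sending the basis element \<open>e_a\<close> to \<open>h a\<close> for
  \<open>a < n\<close>. Differentials and homotopies both take this form, so their composites can be
  computed uniformly.\<close>

definition lin_ext :: "nat \<Rightarrow> (nat \<Rightarrow> nat \<Rightarrow> ('v, 'k::field) mpoly) \<Rightarrow> (nat \<Rightarrow> ('v, 'k) mpoly) \<Rightarrow> nat \<Rightarrow> ('v, 'k) mpoly" where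
  "lin_ext n h u = (\<lambda>b. \<Sum>a<n. u a * h a b)"

abbreviation graded_complex :: "('v::finite, 'k::field) free_complex \<Rightarrow> bool" where
  "graded_complex F \<equiv> \<forall>i. \<forall>a<rk F (Suc i). \<forall>b<rk F i.
     homogeneous (shift F (Suc i) a - shift F i b) (mat F i a b)"

lemma smul_add: "smul p (u + v) = smul p u + smul p v"
  by (simp add: smul_def fun_eq_iff algebra_simps)

lemma smul_diff: "smul p (u - v) = smul p u - smul p v"
  by (simp add: smul_def fun_eq_iff algebra_simps)

lemma smul_0: "smul p 0 = 0"
  by (simp add: smul_def fun_eq_iff)

lemma sqmon_mult_eq_0: "sqmon T * p = 0 \<longleftrightarrow> p = 0"
  using sqmon_mult_mem_sqf_iff[of T p "{}"] by (simp add: sqf_empty colon_def)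

lemma smul_sqmon_eq_0: "smul (sqmon T) u = 0 \<longleftrightarrow> u = 0"
  by (simp add: smul_def fun_eq_iff sqmon_mult_eq_0)

lemma smul_sqmon_inj: "smul (sqmon T) u = smul (sqmon T) v \<longleftrightarrow> u = v"
  using smul_sqmon_eq_0[of T "u - v"] by (simp add: smul_diff)

lemma bd_0: "bd F 0 u = 0"
  by (simp add: bd_def fun_eq_iff)

lemma bd_Suc: "bd F (Suc n) u = (\<lambda>b. if b < rk F n then (\<Sum>a<rk F (Suc n). u a * mat F n a b) else 0)"
  by (simp add: bd_def)

lemma bd_add: "bd F i (u + v) = bd F i u + bd F i v"
  by (cases i) (auto simp: bd_0 bd_Suc fun_eq_iff algebra_simps sum.distrib)

lemma bd_diff: "bd F i (u - v) = bd F i u - bd F i v"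
  by (cases i) (auto simp: bd_0 bd_Suc fun_eq_iff algebra_simps sum_subtractf)

lemma bd_smul: "bd F i (smul p u) = smul p (bd F i u)"
  by (cases i) (auto simp: bd_0 bd_Suc smul_def fun_eq_iff mult.assoc sum_distrib_left)

lemma bd_zero: "bd F i 0 = 0"
  by (cases i) (auto simp: bd_0 bd_Suc fun_eq_iff)

lemma lin_ext_cong: "(\<And>a. a < n \<Longrightarrow> g a = h a) \<Longrightarrow> lin_ext n g u = lin_ext n h u"
  by (simp add: lin_ext_def fun_eq_iff)

lemma bd_lin_ext: "bd F i (lin_ext n h u) = lin_ext n (\<lambda>a. bd F i (h a)) u"
proof (cases i)
  case (Suc k)
  have "(\<Sum>a<rk F (Suc k). (\<Sum>c<n. u c * h c a) * mat F k a b) =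
      (\<Sum>c<n. u c * (\<Sum>a<rk F (Suc k). h c a * mat F k a b))" for b
    unfolding sum_distrib_left sum_distrib_right mult.assoc by (rule sum.swap)
  then show ?thesis
    by (simp add: Suc bd_Suc lin_ext_def fun_eq_iff)
qed (simp add: bd_0 lin_ext_def fun_eq_iff)

lemma bd_basis_vec: "a < rk F (Suc n) \<Longrightarrow> bd F (Suc n) (basis_vec a) = (\<lambda>b. if b < rk F n then mat F n a b else 0)"
  by (simp add: bd_Suc basis_vec_def fun_eq_iff if_distrib[of "\<lambda>x. x * _"] cong: if_cong)

lemma bd_eq_lin_ext: "bd F (Suc n) u = lin_ext (rk F (Suc n)) (\<lambda>a. bd F (Suc n) (basis_vec a)) u"
proof -
  have "lin_ext (rk F (Suc n)) (\<lambda>a. bd F (Suc n) (basis_vec a)) u =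
      lin_ext (rk F (Suc n)) (\<lambda>a b. if b < rk F n then mat F n a b else 0) u"
    by (rule lin_ext_cong) (rule bd_basis_vec)
  then show ?thesis
    by (simp add: fun_eq_iff lin_ext_def bd_Suc)
qed

lemma lin_ext_lin_ext: "lin_ext n (\<lambda>a. lin_ext m h (g a)) u = lin_ext m h (lin_ext n g u)"
proof
  fix b
  have "lin_ext n (\<lambda>a. lin_ext m h (g a)) u b = (\<Sum>a<n. \<Sum>c<m. u a * (g a c * h c b))"
    by (simp add: lin_ext_def sum_distrib_left)
  also have "\<dots> = (\<Sum>c<m. \<Sum>a<n. u a * (g a c * h c b))"
    by (rule sum.swap)
  also have "\<dots> = lin_ext m h (lin_ext n g u) b"
    by (simp add: lin_ext_def sum_distrib_right mult.assoc)
  finally show "lin_ext n (\<lambda>a. lin_ext m h (g a)) u b = lin_ext m h (lin_ext n g u) b" .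
qed

lemma lin_ext_diff: "lin_ext n (\<lambda>a. g a - h a) u = lin_ext n g u - lin_ext n h u"
  by (simp add: lin_ext_def fun_eq_iff algebra_simps sum_subtractf)

lemma lin_ext_0: "lin_ext n h 0 = 0"
  by (simp add: lin_ext_def fun_eq_iff)

section \<open>Graded chains with coefficients in an ideal\<close>

lemma chainsI:
  "(\<And>a. a < rk F i \<Longrightarrow> u a \<in> M) \<Longrightarrow> (\<And>a. a < rk F i \<Longrightarrow> homogeneous (j - shift F i a) (u a)) \<Longrightarrow>
   (\<And>a. a \<ge> rk F i \<Longrightarrow> u a = 0) \<Longrightarrow> u \<in> chains F M i j"
  by (simp add: chains_def)

lemma chains_subset: "M \<subseteq> N \<Longrightarrow> chains F M i j \<subseteq> chains F N i j"
  by (auto simp: chains_def)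

lemma chains_UNIV: "u \<in> chains F M i j \<Longrightarrow> u \<in> chains F UNIV i j"
  by (auto simp: chains_def)

lemma chains_add: "u \<in> chains F (sqf A) i j \<Longrightarrow> v \<in> chains F (sqf A) i j \<Longrightarrow> u + v \<in> chains F (sqf A) i j"
  by (simp add: chains_def sqf_add homogeneous_add)

lemma chains_diff: "u \<in> chains F (sqf A) i j \<Longrightarrow> v \<in> chains F (sqf A) i j \<Longrightarrow> u - v \<in> chains F (sqf A) i j"
  by (simp add: chains_def sqf_diff homogeneous_diff)

lemma chains_0: "0 \<in> chains F (sqf A) i j"
  by (simp add: chains_def sqf_0 homogeneous_0)

text \<open>The family \<open>{{}}\<close> generates the unit ideal, so results about
  \<open>sqf A\<close> specialise to chains of the resolution itself.\<close>

lemmas chains_UNIV_add = chains_add[of _ _ "{{}}", unfolded sqf_top]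
lemmas chains_UNIV_diff = chains_diff[of _ _ "{{}}", unfolded sqf_top]

lemma basis_vec_chains: "a < rk F i \<Longrightarrow> basis_vec a \<in> chains F UNIV i (shift F i a)"
  by (auto simp: chains_def basis_vec_def homogeneous_0 homogeneous_1)

text \<open>The values \<open>h a\<close> need not have coefficients in the ideal, since the
  coefficients of \<open>u\<close> already do. Thus a linear map of degree \<open>d\<close> on the
  resolution also acts on its tensor product with the ideal.\<close>

lemma lin_ext_chains:
  assumes "u \<in> chains F (sqf A) i j"
    and "\<And>a. a < rk F i \<Longrightarrow> h a \<in> chains F UNIV i' (shift F i a + d)"
  shows "lin_ext (rk F i) h u \<in> chains F (sqf A) i' (j + d)"
proof (rule chainsI)
  fix b assume b: "b < rk F i'"
  show "lin_ext (rk F i) h u b \<in> sqf A"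
    unfolding lin_ext_def
    using assms(1) by (intro sqf_sum) (auto simp: chains_def mult.commute[of "u _"] intro!: sqf_mult)
  show "homogeneous (j + d - shift F i' b) (lin_ext (rk F i) h u b)"
    unfolding lin_ext_def
  proof (intro homogeneous_sum)
    fix a assume "a \<in> {..<rk F i}"
    then have "homogeneous ((j - shift F i a) + (shift F i a + d - shift F i' b)) (u a * h a b)"
      using assms b by (intro homogeneous_mult) (auto simp: chains_def)
    then show "homogeneous (j + d - shift F i' b) (u a * h a b)"
      by (simp add: algebra_simps)
  qed
next
  fix b assume "rk F i' \<le> b"
  then show "lin_ext (rk F i) h u b = 0"
    using assms(2) by (auto simp: lin_ext_def chains_def intro!: sum.neutral)
qed

lemma bd_chains:
  assumes "graded_complex F" and "u \<in> chains F (sqf A) (Suc i) j"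
  shows "bd F (Suc i) u \<in> chains F (sqf A) i j"
proof -
  have "bd F (Suc i) (basis_vec a) \<in> chains F UNIV i (shift F (Suc i) a + 0)" if "a < rk F (Suc i)" for a
    using assms(1) that by (intro chainsI) (auto simp: bd_basis_vec)
  from lin_ext_chains[OF assms(2) this] show ?thesis
    unfolding bd_eq_lin_ext[symmetric] by simp
qed

lemmas bd_chains_UNIV = bd_chains[of _ _ "{{}}", unfolded sqf_top]

text \<open>This identifies chains over the intersection of the ideal with the principal ideal of
  \<open>T\<close> with chains over the colon ideal, shifted by the degree of the monomial.\<close>

lemma smul_sqmon_chains_iff:
  "smul (sqmon T) u \<in> chains F (sqf A) i j \<longleftrightarrow> u \<in> chains F (sqf (colon A T)) i (j - int (card T))"
proof -
  have "homogeneous (j - shift F i a) (sqmon T * u a) \<longleftrightarrow> homogeneous (j - int (card T) - shift F i a) (u a)" for a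
    by (simp add: homogeneous_sqmon_mult_iff algebra_simps)
  then show ?thesis
    by (simp add: chains_def smul_def sqmon_mult_mem_sqf_iff sqmon_mult_eq_0)
qed

lemma smul_sqmon_chains:
  assumes "u \<in> chains F UNIV i (j - int (card T))" and "T \<in> A"
  shows "smul (sqmon T) u \<in> chains F (sqf A) i j"
proof -
  have "sqf (colon A T) = (UNIV :: ('a, 'b) mpoly set)"
    using sqf_subset[of "{{}}" "colon A T"] assms(2) by (auto simp: colon_def sqf_top)
  then show ?thesis
    using assms(1) by (simp add: smul_sqmon_chains_iff)
qed

text \<open>Applies \<open>sqf_insert_split\<close> in each coordinate: the chain-level surjection
  of the Mayer--Vietoris sequence. The pair \<open>w1\<close>, \<open>w2\<close> is not
  unique.\<close>

lemma chains_insert_split: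
  assumes "w \<in> chains F (sqf (insert T A)) i j"
  obtains w1 w2 where "w1 \<in> chains F (sqf A) i j" "w2 \<in> chains F UNIV i (j - int (card T))"
    "w = w1 + smul (sqmon T) w2"
proof -
  have "\<exists>q r. w a = q + sqmon T * r \<and> q \<in> sqf A \<and> homogeneous (j - shift F i a) q \<and>
      homogeneous (j - shift F i a - int (card T)) r" if "a < rk F i" for a
  proof -
    have "w a \<in> sqf (insert T A)" "homogeneous (j - shift F i a) (w a)"
      using assms that by (auto simp: chains_def)
    then show ?thesis
      by (rule sqf_insert_split) blast
  qed
  then obtain q r where qr: "\<And>a. a < rk F i \<Longrightarrow> w a = q a + sqmon T * r a \<and> q a \<in> sqf A \<and>
      homogeneous (j - shift F i a) (q a) \<and> homogeneous (j - shift F i a - int (card T)) (r a)"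
    by metis
  define w1 w2 where "w1 = (\<lambda>a. if a < rk F i then q a else 0)"
    and "w2 = (\<lambda>a. if a < rk F i then r a else 0)"
  show ?thesis
  proof (rule that)
    show "w1 \<in> chains F (sqf A) i j" "w2 \<in> chains F UNIV i (j - int (card T))"
      using qr by (auto simp: w1_def w2_def chains_def algebra_simps)
    show "w = w1 + smul (sqmon T) w2"
      using qr assms by (auto simp: w1_def w2_def chains_def fun_eq_iff smul_def)
  qed
qed

lemma smul_eq_lin_ext:
  assumes "u \<in> chains F UNIV i j"
  shows "smul p u = lin_ext (rk F i) (\<lambda>a. smul p (basis_vec a)) u"
  using assms by (auto simp: fun_eq_iff smul_def lin_ext_def basis_vec_def chains_def
    if_distrib[of "\<lambda>x. _ * x"] mult.commute not_less cong: if_cong)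

lemma smul_sqmon_basis_vec_chains:
  assumes "a < rk F i"
  shows "smul (sqmon T) (basis_vec a) \<in> chains F UNIV i (shift F i a + int (card T))"
  using basis_vec_chains[OF assms] smul_sqmon_chains_iff[of T _ F "{{}}"]
  by (simp add: colon_def sqf_top)

lemma cycles_iff: "u \<in> cycles F M i j \<longleftrightarrow> u \<in> chains F M i j \<and> bd F i u = 0"
  by (auto simp: cycles_def zero_fun_def)

lemma boundaries_iff: "u \<in> boundaries F M i j \<longleftrightarrow> (\<exists>w\<in>chains F M (Suc i) j. u = bd F (Suc i) w)"
  by (auto simp: boundaries_def)

section \<open>Working with one fixed resolution of the residue field\<close>

context
  fixes F :: "('v::finite, 'k::field) free_complex"
  assumes res: "graded_free_resolution_of_k F"
begin

lemma graded: "graded_complex F"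
  using res by (simp add: graded_free_resolution_of_k_def)

lemma exact: "cycles F UNIV (Suc i) j = boundaries F UNIV (Suc i) j"
  using res by (simp add: graded_free_resolution_of_k_def)

lemma exact_0:
  obtains \<epsilon> where "\<And>a. a < rk F 0 \<Longrightarrow> \<epsilon> a \<noteq> 0 \<Longrightarrow> shift F 0 a = 0"
    and "\<And>j. {u \<in> chains F UNIV 0 j. augmentation F \<epsilon> u = 0} = boundaries F UNIV 0 j"
    and "augmentation F \<epsilon> ` chains F UNIV 0 0 = UNIV"
  using res by (auto simp: graded_free_resolution_of_k_def)

text \<open>The augmentation sees only constant coefficients, and only at basis elements of degree
  0. Hence the rank of the degree 0 module need not be known.\<close>

lemma boundary_0I:
  assumes "u \<in> chains F UNIV 0 j"
    and "\<And>a. a < rk F 0 \<Longrightarrow> shift F 0 a = 0 \<Longrightarrow> Poly_Mapping.lookup (u a) 0 = 0"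
  shows "u \<in> boundaries F UNIV 0 j"
proof -
  obtain \<epsilon> where \<epsilon>: "\<And>a. a < rk F 0 \<Longrightarrow> \<epsilon> a \<noteq> 0 \<Longrightarrow> shift F 0 a = 0"
    "\<And>j. {u \<in> chains F UNIV 0 j. augmentation F \<epsilon> u = 0} = boundaries F UNIV 0 j"
    by (rule exact_0) blast
  have "augmentation F \<epsilon> u = 0"
    unfolding augmentation_def using \<epsilon>(1) assms(2) by (intro sum.neutral) fastforce
  then show ?thesis
    using assms(1) \<epsilon>(2) by blast
qed

lemma bd_bd: "u \<in> chains F UNIV (Suc i) j \<Longrightarrow> bd F i (bd F (Suc i) u) = 0"
proof (cases i)
  case (Suc k)
  assume "u \<in> chains F UNIV (Suc i) j"
  then have "bd F (Suc i) u \<in> boundaries F UNIV (Suc k) j"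
    by (auto simp: boundaries_def Suc)
  then show ?thesis
    unfolding exact[symmetric] by (simp add: Suc cycles_iff)
qed (simp add: bd_0)

text \<open>Multiplication by a monomial of positive degree induces zero on \<open>k\<close>, so it
  is null-homotopic on a resolution. The homotopy is built by induction on \<open>i\<close>; on
  cycles the identity \<open>f = dh + hd\<close> reduces to \<open>f = dh\<close>, which is all that
  is recorded.\<close>

lemma homotopy:
  assumes "T \<noteq> {}"
  shows "\<exists>h. (\<forall>a<rk F i. h a \<in> chains F UNIV (Suc i) (shift F i a + int (card T))) \<and>
    (\<forall>j. \<forall>u\<in>cycles F UNIV i j. smul (sqmon T) u = bd F (Suc i) (lin_ext (rk F i) h u))"
proof (induction i)
  case 0
  have "\<exists>w\<in>chains F UNIV (Suc 0) (shift F 0 a + int (card T)). smul (sqmon T) (basis_vec a) = bd F (Suc 0) w"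
    if "a < rk F 0" for a
  proof -
    have "smul (sqmon T) (basis_vec a) \<in> boundaries F UNIV 0 (shift F 0 a + int (card T))"
    proof (rule boundary_0I)
      show "smul (sqmon T) (basis_vec a) \<in> chains F UNIV 0 (shift F 0 a + int (card T))"
        using that by (rule smul_sqmon_basis_vec_chains)
      \<comment> \<open>Nonemptiness of \<open>T\<close> enters here: the monomial has positive
        degree, hence no constant term.\<close>
      have "Poly_Mapping.lookup (sqmon T) 0 = (0 :: 'k)"
        using homogeneous_lookup_0[OF homogeneous_sqmon[of T]] assms by simp
      then show "Poly_Mapping.lookup (smul (sqmon T) (basis_vec a) b) 0 = (0 :: 'k)" for b
        by (simp add: smul_def basis_vec_def)
    qed
    then show ?thesis by (simp add: boundaries_iff)
  qed
  then obtain h where h: "\<And>a. a < rk F 0 \<Longrightarrow> h a \<in> chains F UNIV (Suc 0) (shift F 0 a + int (card T))"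
    "\<And>a. a < rk F 0 \<Longrightarrow> smul (sqmon T) (basis_vec a) = bd F (Suc 0) (h a)"
    by metis
  have "smul (sqmon T) u = bd F (Suc 0) (lin_ext (rk F 0) h u)" if "u \<in> cycles F UNIV 0 j" for u j
    using that h(2) by (auto simp: cycles_iff smul_eq_lin_ext bd_lin_ext intro!: lin_ext_cong)
  then show ?case
    using h(1) by blast
next
  case (Suc i)
  then obtain h where h: "\<And>a. a < rk F i \<Longrightarrow> h a \<in> chains F UNIV (Suc i) (shift F i a + int (card T))"
    "\<And>j u. u \<in> cycles F UNIV i j \<Longrightarrow> smul (sqmon T) u = bd F (Suc i) (lin_ext (rk F i) h u)"
    by blast
  \<comment> \<open>The defect \<open>f e_a - h(d e_a)\<close>. It is a cycle because the induction
    hypothesis applies to the cycle \<open>d e_a\<close>; exactness then yields the next value of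
    the homotopy.\<close>
  let ?c = "\<lambda>a. smul (sqmon T) (basis_vec a) - lin_ext (rk F i) h (bd F (Suc i) (basis_vec a))"
  have "\<exists>w\<in>chains F UNIV (Suc (Suc i)) (shift F (Suc i) a + int (card T)). ?c a = bd F (Suc (Suc i)) w"
    if a: "a < rk F (Suc i)" for a
  proof -
    let ?v = "bd F (Suc i) (basis_vec a)"
    have v: "?v \<in> cycles F UNIV i (shift F (Suc i) a)"
      using a by (auto simp: cycles_iff intro!: bd_chains_UNIV graded basis_vec_chains bd_bd)
    have "?c a \<in> chains F UNIV (Suc i) (shift F (Suc i) a + int (card T))"
      using v lin_ext_chains[of ?v F "{{}}" i _ h] h(1)
      by (intro chains_UNIV_diff smul_sqmon_basis_vec_chains a) (auto simp: sqf_top cycles_iff)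
    moreover have "bd F (Suc i) (?c a) = 0"
      using h(2)[OF v] by (simp add: bd_diff bd_smul)
    ultimately have "?c a \<in> cycles F UNIV (Suc i) (shift F (Suc i) a + int (card T))"
      by (simp add: cycles_iff)
    then show ?thesis by (simp add: exact boundaries_iff)
  qed
  then obtain g where g: "\<And>a. a < rk F (Suc i) \<Longrightarrow> g a \<in> chains F UNIV (Suc (Suc i)) (shift F (Suc i) a + int (card T))"
    "\<And>a. a < rk F (Suc i) \<Longrightarrow> ?c a = bd F (Suc (Suc i)) (g a)"
    by metis
  have "smul (sqmon T) u = bd F (Suc (Suc i)) (lin_ext (rk F (Suc i)) g u)"
    if u: "u \<in> cycles F UNIV (Suc i) j" for u j
  proof -
    have "bd F (Suc (Suc i)) (lin_ext (rk F (Suc i)) g u) = lin_ext (rk F (Suc i)) ?c u"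
      unfolding bd_lin_ext by (rule lin_ext_cong) (simp add: g(2))
    also have "\<dots> = smul (sqmon T) u - lin_ext (rk F i) h (bd F (Suc i) u)"
      using u unfolding lin_ext_diff lin_ext_lin_ext bd_eq_lin_ext[symmetric]
      using smul_eq_lin_ext[of u F "Suc i" j "sqmon T"] by (simp add: cycles_iff)
    finally show ?thesis
      using u by (simp add: cycles_iff lin_ext_0)
  qed
  then show ?case
    using g(1) by blast
qed

text \<open>The homotopy is linear, so by \<open>lin_ext_chains\<close> it keeps coefficients inside
  the ideal: the monomial annihilates Tor of the ideal.\<close>

lemma smul_cycle_is_boundary:
  assumes "T \<noteq> {}" and "u \<in> cycles F (sqf A) i j"
  obtains w where "w \<in> chains F (sqf A) (Suc i) (j + int (card T))"
    "smul (sqmon T) u = bd F (Suc i) w"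
proof -
  obtain h where h: "\<And>a. a < rk F i \<Longrightarrow> h a \<in> chains F UNIV (Suc i) (shift F i a + int (card T))"
    "\<And>j u. u \<in> cycles F UNIV i j \<Longrightarrow> smul (sqmon T) u = bd F (Suc i) (lin_ext (rk F i) h u)"
    using homotopy[OF assms(1), of i] by blast
  show ?thesis
  proof (rule that)
    show "lin_ext (rk F i) h u \<in> chains F (sqf A) (Suc i) (j + int (card T))"
      using assms(2) h(1) by (intro lin_ext_chains) (auto simp: cycles_iff)
    show "smul (sqmon T) u = bd F (Suc i) (lin_ext (rk F i) h u)"
      using assms(2) by (intro h(2)) (auto simp: cycles_iff intro: chains_UNIV)
  qed
qed

end

section \<open>Long exact sequences\<close>

lemma colon_disjoint:
  assumes "\<And>S. S \<in> A \<Longrightarrow> S \<inter> T = {}"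
  shows "colon A T = A"
proof -
  have "colon A T = (\<lambda>S. S) ` A"
    unfolding colon_def using assms by (intro image_cong) auto
  then show ?thesis by simp
qed

lemma Tor_nonzero_iff:
  "Tor_nonzero (sqf A :: ('v::finite, 'k::field) mpoly set) i j \<longleftrightarrow>
    (\<exists>F :: ('v, 'k) free_complex. graded_free_resolution_of_k F \<and>
      (\<exists>u\<in>cycles F (sqf A) i j. u \<notin> boundaries F (sqf A) i j))"
proof -
  have "boundaries F (sqf A) i j \<subseteq> cycles F (sqf A) i j"
    if "graded_free_resolution_of_k F" for F :: "('v, 'k) free_complex"
    by (auto simp: boundaries_iff cycles_iff bd_bd[OF that chains_UNIV] bd_chains[OF graded[OF that]])
  then show ?thesis
    unfolding Tor_nonzero_def by blast
qed

text \<open>\<open>Tor_nonzero\<close> quantifies existentially over resolutions, so its negation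
  speaks about every resolution, in particular the one from which a cycle was already
  chosen.\<close>

lemma Tor_zero_boundary:
  fixes F :: "('v::finite, 'k::field) free_complex"
  assumes "graded_free_resolution_of_k F" and "u \<in> cycles F (sqf A) i j"
    and "\<not> Tor_nonzero (sqf A :: ('v, 'k) mpoly set) i j"
  shows "\<exists>w\<in>chains F (sqf A) (Suc i) j. u = bd F (Suc i) w"
  using assms unfolding Tor_nonzero_iff boundaries_iff by blast

text \<open>With \<open>I\<close> the ideal of \<open>A\<close> and \<open>f\<close> the monomial of
  \<open>T\<close>, a class of \<open>I\<close> that dies in \<open>I + (f)\<close> comes from the
  intersection of \<open>I\<close> and \<open>(f)\<close>, which is a shifted copy of
  \<open>I : f\<close>.\<close>

lemma Tor_colon_or_insert:
  fixes A :: "'v::finite set set"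
  assumes "Tor_nonzero (sqf A :: ('v, 'k::field) mpoly set) i j"
  shows "Tor_nonzero (sqf (insert T A) :: ('v, 'k) mpoly set) i j \<or>
    Tor_nonzero (sqf (colon A T) :: ('v, 'k) mpoly set) i (j - int (card T))"
proof (rule ccontr)
  assume neg: "\<not> ?thesis"
  obtain F :: "('v, 'k) free_complex" and u where F: "graded_free_resolution_of_k F"
    and u: "u \<in> cycles F (sqf A) i j" "u \<notin> boundaries F (sqf A) i j"
    using assms by (auto simp: Tor_nonzero_iff)
  have "sqf A \<subseteq> (sqf (insert T A) :: ('v, 'k) mpoly set)"
    by (rule sqf_subset) auto
  then have "u \<in> cycles F (sqf (insert T A)) i j"
    using u(1) chains_subset[of "sqf A" "sqf (insert T A)" F i j] by (auto simp: cycles_iff)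
  then obtain w where w: "w \<in> chains F (sqf (insert T A)) (Suc i) j" "u = bd F (Suc i) w"
    using neg Tor_zero_boundary[OF F] by blast
  obtain w1 w2 where w12: "w1 \<in> chains F (sqf A) (Suc i) j"
    "w2 \<in> chains F UNIV (Suc i) (j - int (card T))" "w = w1 + smul (sqmon T) w2"
    using w(1) by (rule chains_insert_split)
  let ?v = "bd F (Suc i) w2"
  have v: "smul (sqmon T) ?v = u - bd F (Suc i) w1"
    by (simp add: w(2) w12(3) bd_add bd_smul)
  have "smul (sqmon T) ?v \<in> chains F (sqf A) i j"
    unfolding v using u(1) w12(1) F by (auto simp: cycles_iff intro!: chains_diff bd_chains[OF graded[OF F]])
  then have "?v \<in> cycles F (sqf (colon A T)) i (j - int (card T))"
    using w12(2) F by (simp add: smul_sqmon_chains_iff cycles_iff bd_bd)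
  then obtain w3 where w3: "w3 \<in> chains F (sqf (colon A T)) (Suc i) (j - int (card T))"
    "?v = bd F (Suc i) w3"
    using neg Tor_zero_boundary[OF F] by blast
  \<comment> \<open>Replacing \<open>w2\<close> by \<open>w3\<close> keeps the boundary and moves
    the bounding chain into the smaller ideal.\<close>
  have "u = bd F (Suc i) (w1 + smul (sqmon T) w3)"
    using v w3(2) by (simp add: bd_add bd_smul algebra_simps)
  moreover have "w1 + smul (sqmon T) w3 \<in> chains F (sqf A) (Suc i) j"
    using w12(1) w3(1) by (simp add: chains_add smul_sqmon_chains_iff)
  ultimately show False
    using u(2) by (auto simp: boundaries_iff)
qed

text \<open>The next portion of the Mayer--Vietoris sequence. The principal ideal \<open>(f)\<close>
  is free, so it contributes only to homological degree 0, in the degree of \<open>f\<close>; the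
  colon ideal enters through the connecting map, which lowers the homological degree by one.\<close>

lemma Tor_insert_cases:
  fixes A :: "'v::finite set set"
  assumes "Tor_nonzero (sqf (insert T A) :: ('v, 'k::field) mpoly set) i j"
  shows "Tor_nonzero (sqf A :: ('v, 'k) mpoly set) i j \<or> (i = 0 \<and> j = int (card T)) \<or>
    (\<exists>n. i = Suc n \<and> Tor_nonzero (sqf (colon A T) :: ('v, 'k) mpoly set) n (j - int (card T)))"
proof (rule ccontr)
  assume neg: "\<not> ?thesis"
  obtain F :: "('v, 'k) free_complex" and u where F: "graded_free_resolution_of_k F"
    and u: "u \<in> cycles F (sqf (insert T A)) i j" "u \<notin> boundaries F (sqf (insert T A)) i j"
    using assms by (auto simp: Tor_nonzero_iff)
  obtain u1 u2 where u12: "u1 \<in> chains F (sqf A) i j"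
    "u2 \<in> chains F UNIV i (j - int (card T))" "u = u1 + smul (sqmon T) u2"
    using u(1) by (auto simp: cycles_iff elim: chains_insert_split)
  \<comment> \<open>The chain \<open>w\<close> has the same boundary as \<open>u2\<close> but
    coefficients in the colon ideal, so \<open>u1 + f w\<close> becomes a cycle over the smaller
    ideal and \<open>f (u2 - w)\<close> is a boundary over \<open>(f)\<close>.\<close>
  obtain w where w: "w \<in> chains F (sqf (colon A T)) i (j - int (card T))" "bd F i w = bd F i u2"
    "u2 - w \<in> boundaries F UNIV i (j - int (card T))"
  proof (cases i)
    case 0
    \<comment> \<open>Here \<open>w = 0\<close> suffices: \<open>j\<close> differs from
      \<open>card T\<close>, so \<open>u2\<close> has nonzero degree and no constant coefficient at
      a basis element of degree 0.\<close>
    have "u2 \<in> boundaries F UNIV 0 (j - int (card T))"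
    proof (rule boundary_0I[OF F])
      show "u2 \<in> chains F UNIV 0 (j - int (card T))"
        using u12(2) 0 by simp
      then show "Poly_Mapping.lookup (u2 a) 0 = 0" if "a < rk F 0" "shift F 0 a = 0" for a
        using neg 0 that homogeneous_lookup_0[of "j - int (card T)" "u2 a"] by (auto simp: chains_def)
    qed
    then show ?thesis
      using that[of 0] 0 by (simp add: chains_0 bd_0)
  next
    case (Suc n)
    have eq: "smul (sqmon T) (bd F i u2) = 0 - bd F i u1"
      using u(1) unfolding cycles_iff u12(3) bd_add bd_smul by (metis add_diff_cancel_left')
    have "smul (sqmon T) (bd F i u2) \<in> chains F (sqf A) n j"
      unfolding eq using u12(1) F Suc by (intro chains_diff chains_0) (auto intro!: bd_chains[OF graded[OF F]])
    then have "bd F i u2 \<in> cycles F (sqf (colon A T)) n (j - int (card T))"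
      using u12(2) F Suc by (simp add: smul_sqmon_chains_iff cycles_iff bd_bd)
    then obtain w where w: "w \<in> chains F (sqf (colon A T)) i (j - int (card T))" "bd F i u2 = bd F i w"
      using neg Tor_zero_boundary[OF F] Suc by blast
    have "u2 - w \<in> cycles F UNIV i (j - int (card T))"
      using w u12(2) by (auto simp: cycles_iff bd_diff intro!: chains_UNIV_diff intro: chains_UNIV)
    then have "u2 - w \<in> boundaries F UNIV i (j - int (card T))"
      using exact[OF F] Suc by simp
    then show ?thesis
      using that w by simp
  qed
  obtain w' where w': "w' \<in> chains F UNIV (Suc i) (j - int (card T))" "u2 - w = bd F (Suc i) w'"
    using w(3) by (auto simp: boundaries_iff)
  have "u1 + smul (sqmon T) w \<in> cycles F (sqf A) i j"
    using u(1) u12(1) w(1,2) unfolding cycles_iff u12(3) bd_add bd_smul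
    by (simp add: chains_add smul_sqmon_chains_iff)
  then obtain w'' where w'': "w'' \<in> chains F (sqf A) (Suc i) j" "u1 + smul (sqmon T) w = bd F (Suc i) w''"
    using neg Tor_zero_boundary[OF F] by blast
  have sub: "sqf A \<subseteq> (sqf (insert T A) :: ('v, 'k) mpoly set)"
    by (rule sqf_subset) auto
  have "w'' + smul (sqmon T) w' \<in> chains F (sqf (insert T A)) (Suc i) j"
    using w''(1) w'(1) chains_subset[OF sub] by (intro chains_add smul_sqmon_chains) auto
  moreover have "u = bd F (Suc i) (w'' + smul (sqmon T) w')"
    by (simp add: bd_add bd_smul flip: w''(2) w'(2)) (simp add: u12(3) smul_diff)
  ultimately show False
    using u(2) by (auto simp: boundaries_iff)
qed

text \<open>If \<open>x\<close> divides no generator of \<open>J\<close> and \<open>J \<subseteq> I \<subseteq> J + (x)\<close>, then \<open>Tor(J) \<rightarrow> Tor(I)\<close> is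
  injective, since multiplication by \<open>x\<close> is zero on \<open>Tor\<close>.\<close>

lemma Tor_restrict_var:
  fixes A :: "'v::finite set set"
  assumes "Tor_nonzero (sqf {S \<in> A. x \<notin> S} :: ('v, 'k::field) mpoly set) i j"
  shows "Tor_nonzero (sqf A :: ('v, 'k) mpoly set) i j"
proof (rule ccontr)
  define B where "B = {S \<in> A. x \<notin> S}"
  assume neg: "\<not> ?thesis"
  obtain F :: "('v, 'k) free_complex" and u where F: "graded_free_resolution_of_k F"
    and u: "u \<in> cycles F (sqf B) i j" "u \<notin> boundaries F (sqf B) i j"
    using assms by (auto simp: Tor_nonzero_iff B_def)
  have sub: "sqf B \<subseteq> (sqf A :: ('v, 'k) mpoly set)" "sqf A \<subseteq> (sqf (insert {x} B) :: ('v, 'k) mpoly set)"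
    by (rule sqf_subset; auto simp: B_def)+
  have B: "colon B {x} = B"
    by (rule colon_disjoint) (auto simp: B_def)
  have "u \<in> cycles F (sqf A) i j"
    using u(1) chains_subset[OF sub(1)] by (auto simp: cycles_iff)
  then obtain w where w: "w \<in> chains F (sqf A) (Suc i) j" "u = bd F (Suc i) w"
    using neg Tor_zero_boundary[OF F] by blast
  obtain w1 w2 where w12: "w1 \<in> chains F (sqf B) (Suc i) j"
    "w2 \<in> chains F UNIV (Suc i) (j - int (card {x}))" "w = w1 + smul (sqmon {x}) w2"
    using w(1) chains_subset[OF sub(2)] by (blast elim: chains_insert_split)
  let ?v = "bd F (Suc i) w2"
  have v: "smul (sqmon {x}) ?v = u - bd F (Suc i) w1"
    by (simp add: w(2) w12(3) bd_add bd_smul)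
  have "smul (sqmon {x}) ?v \<in> chains F (sqf B) i j"
    unfolding v using u(1) w12(1) F by (auto simp: cycles_iff intro!: chains_diff bd_chains[OF graded[OF F]])
  then have "?v \<in> cycles F (sqf B) i (j - int (card {x}))"
    using w12(2) F by (simp add: smul_sqmon_chains_iff cycles_iff bd_bd B)
  then obtain w3 where w3: "w3 \<in> chains F (sqf B) (Suc i) (j - int (card {x}) + int (card {x}))"
    "smul (sqmon {x}) ?v = bd F (Suc i) w3"
    by (rule smul_cycle_is_boundary[OF F, rotated, where T = "{x}"]) auto
  have "u = bd F (Suc i) (w1 + w3)"
    using v w3(2) by (simp add: bd_add algebra_simps)
  moreover have "w1 + w3 \<in> chains F (sqf B) (Suc i) j"
    using w12(1) w3(1) by (simp add: chains_add)
  ultimately show False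
    using u(2) by (auto simp: boundaries_iff)
qed

text \<open>The variables outside \<open>W\<close> are removed one at a time with
  \<open>Tor_restrict_var\<close>. For path ideals this is passage to an induced subgraph.\<close>

lemma Tor_restrict:
  fixes A :: "'v::finite set set"
  assumes "Tor_nonzero (sqf {S \<in> A. S \<subseteq> W} :: ('v, 'k::field) mpoly set) i j"
  shows "Tor_nonzero (sqf A :: ('v, 'k) mpoly set) i j"
proof -
  have "Tor_nonzero (sqf {S \<in> A. S \<inter> U = {}} :: ('v, 'k) mpoly set) i j \<Longrightarrow> ?thesis" for U
  proof (induction U rule: finite_induct[OF finite])
    case (2 x U)
    have eq: "{S \<in> A. S \<inter> insert x U = {}} = {S \<in> {S \<in> A. S \<inter> U = {}}. x \<notin> S}"
      by auto
    show ?case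
      using 2(4) unfolding eq by (rule 2(3)[OF Tor_restrict_var])
  qed auto
  moreover have "{S \<in> A. S \<subseteq> W} = {S \<in> A. S \<inter> (- W) = {}}"
    by auto
  ultimately show ?thesis
    using assms by simp
qed

text \<open>Disjointness gives \<open>I : f = I\<close>. On Tor, multiplication by \<open>f\<close>
  on \<open>I\<close> is zero and the inclusion of the proper ideal \<open>I\<close> into
  \<open>S\<close> is zero, so every class of \<open>I\<close> is hit by the connecting map from
  \<open>I + (f)\<close>.\<close>

lemma Tor_insert_disjoint:
  fixes A :: "'v::finite set set"
  assumes "Tor_nonzero (sqf A :: ('v, 'k::field) mpoly set) i j"
    and T: "T \<noteq> {}" "\<And>S. S \<in> A \<Longrightarrow> S \<inter> T = {}" and A: "{} \<notin> A"
  shows "Tor_nonzero (sqf (insert T A) :: ('v, 'k) mpoly set) (Suc i) (j + int (card T))"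
proof (rule ccontr)
  assume neg: "\<not> ?thesis"
  obtain F :: "('v, 'k) free_complex" and u where F: "graded_free_resolution_of_k F"
    and u: "u \<in> cycles F (sqf A) i j" "u \<notin> boundaries F (sqf A) i j"
    using assms(1) by (auto simp: Tor_nonzero_iff)
  have colon: "colon A T = A"
    using T(2) by (rule colon_disjoint)
  have sub: "sqf A \<subseteq> (sqf (insert T A) :: ('v, 'k) mpoly set)"
    by (rule sqf_subset) auto
  obtain w1 where w1: "w1 \<in> chains F (sqf A) (Suc i) (j + int (card T))"
    "smul (sqmon T) u = bd F (Suc i) w1"
    using smul_cycle_is_boundary[OF F T(1) u(1)] by blast
  \<comment> \<open>The class of \<open>u\<close> dies in Tor of \<open>S\<close>: for
    \<open>i = 0\<close> because the ideal is proper, otherwise by exactness.\<close>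
  have "u \<in> boundaries F UNIV i j"
  proof (cases i)
    case 0
    have "u \<in> chains F (sqf A) 0 j"
      using u(1) 0 by (simp add: cycles_iff)
    then have "u \<in> boundaries F UNIV 0 j"
      using lookup_zero_sqf[OF A] by (intro boundary_0I[OF F] chains_UNIV) (auto simp: chains_def)
    then show ?thesis using 0 by simp
  next
    case (Suc n)
    have "u \<in> cycles F UNIV (Suc n) j"
      using u(1) Suc by (auto simp: cycles_iff intro: chains_UNIV)
    then show ?thesis using exact[OF F] Suc by simp
  qed
  then obtain w2 where w2: "w2 \<in> chains F UNIV (Suc i) j" "u = bd F (Suc i) w2"
    by (auto simp: boundaries_iff)
  \<comment> \<open>The chain \<open>f u\<close> bounds both over \<open>I\<close> and over
    \<open>(f)\<close>; the difference of the two bounding chains is the preimage under the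
    connecting map.\<close>
  have "w1 - smul (sqmon T) w2 \<in> chains F (sqf (insert T A)) (Suc i) (j + int (card T))"
    using w1(1) w2(1) chains_subset[OF sub] by (intro chains_diff smul_sqmon_chains) auto
  then have "w1 - smul (sqmon T) w2 \<in> cycles F (sqf (insert T A)) (Suc i) (j + int (card T))"
    using w1(2) w2(2) by (simp add: cycles_iff bd_diff bd_smul)
  then obtain w where w: "w \<in> chains F (sqf (insert T A)) (Suc (Suc i)) (j + int (card T))"
    "w1 - smul (sqmon T) w2 = bd F (Suc (Suc i)) w"
    using neg Tor_zero_boundary[OF F] by blast
  obtain v1 v2 where v: "v1 \<in> chains F (sqf A) (Suc (Suc i)) (j + int (card T))"
    "v2 \<in> chains F UNIV (Suc (Suc i)) (j + int (card T) - int (card T))" "w = v1 + smul (sqmon T) v2"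
    using w(1) by (rule chains_insert_split)
  \<comment> \<open>If that preimage bounds, then \<open>f q\<close> lies over \<open>I\<close>, so
    \<open>q\<close> lies over \<open>I : f = I\<close>, while its boundary is still
    \<open>u\<close>.\<close>
  let ?q = "w2 + bd F (Suc (Suc i)) v2"
  have eq: "smul (sqmon T) ?q = w1 - bd F (Suc (Suc i)) v1"
    using w(2) unfolding v(3) smul_add bd_add bd_smul by (simp add: algebra_simps)
  have "smul (sqmon T) ?q \<in> chains F (sqf A) (Suc i) (j + int (card T))"
    unfolding eq using w1(1) v(1) F by (intro chains_diff) (auto intro!: bd_chains[OF graded[OF F]])
  then have "?q \<in> chains F (sqf A) (Suc i) j"
    by (simp add: smul_sqmon_chains_iff colon)
  moreover have "bd F (Suc i) ?q = u"
    using w2 v(2) F by (simp add: bd_add bd_bd)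
  ultimately show False
    using u(2) by (auto simp: boundaries_iff)
qed

text \<open>The class is \<open>f\<close> times a chain of augmentation 1. If it bounded over
  \<open>(f)\<close>, cancelling \<open>f\<close> would make a chain of augmentation 1 a
  boundary.\<close>

lemma Tor_singleton:
  fixes F :: "('v::finite, 'k::field) free_complex"
  assumes F: "graded_free_resolution_of_k F"
  shows "Tor_nonzero (sqf {T} :: ('v, 'k) mpoly set) 0 (int (card T))"
proof (rule ccontr)
  assume neg: "\<not> ?thesis"
  obtain \<epsilon> where \<epsilon>: "\<And>j. {u \<in> chains F UNIV 0 j. augmentation F \<epsilon> u = 0} = boundaries F UNIV 0 j"
    "augmentation F \<epsilon> ` chains F UNIV 0 0 = UNIV"
    by (rule exact_0[OF F]) blast
  obtain u where u: "u \<in> chains F UNIV 0 0" "augmentation F \<epsilon> u = 1"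
    using \<epsilon>(2) by (metis UNIV_I imageE)
  have "smul (sqmon T) u \<in> cycles F (sqf {T}) 0 (int (card T))"
    using u(1) by (auto simp: cycles_iff bd_0 intro!: smul_sqmon_chains)
  then obtain w where w: "w \<in> chains F (sqf {T}) (Suc 0) (int (card T))" "smul (sqmon T) u = bd F (Suc 0) w"
    using neg Tor_zero_boundary[OF F] by blast
  obtain w1 w2 where w12: "w1 \<in> chains F (sqf {}) (Suc 0) (int (card T))"
    "w2 \<in> chains F UNIV (Suc 0) (int (card T) - int (card T))" "w = w1 + smul (sqmon T) w2"
    using w(1) by (rule chains_insert_split)
  have "w1 a = 0" for a
    using w12(1) by (cases "a < rk F (Suc 0)") (auto simp: chains_def sqf_empty)
  then have "w1 = 0" by (simp add: fun_eq_iff)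
  then have "u = bd F (Suc 0) w2"
    using w(2) unfolding w12(3) by (simp add: bd_smul smul_sqmon_inj)
  then have "u \<in> boundaries F UNIV 0 0"
    using w12(2) by (auto simp: boundaries_iff)
  then show False
    unfolding \<epsilon>(1)[symmetric] using u(2) by simp
qed

section \<open>Existence of a resolution\<close>

definition cone_rk :: "('v, 'k::field) free_complex \<Rightarrow> nat \<Rightarrow> nat" where
  "cone_rk F i = (case i of 0 \<Rightarrow> 0 | Suc n \<Rightarrow> rk F n)"

text \<open>The mapping cone \<open>F\<^sub>i \<oplus> F\<^bsub>i-1\<^esub>(-1)\<close> of multiplication by a linear form \<open>p\<close>, with differential
  \<open>(u, v) \<mapsto> (\<partial>u + pv, -\<partial>v)\<close>; the second summand is empty for \<open>i = 0\<close>, so the truncated \<open>i - 1\<close> is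
  never reached there.\<close>

definition cone :: "('v, 'k::field) mpoly \<Rightarrow> ('v, 'k) free_complex \<Rightarrow> ('v, 'k) free_complex" where
  "cone p F = \<lparr>rk = (\<lambda>i. rk F i + cone_rk F i),
     shift = (\<lambda>i a. if a < rk F i then shift F i a else shift F (i - 1) (a - rk F i) + 1),
     mat = (\<lambda>i a b.
       if a < rk F (Suc i) then (if b < rk F i then mat F i a b else 0)
       else if b < rk F i then (if b = a - rk F (Suc i) then p else 0)
       else - mat F (i - 1) (a - rk F (Suc i)) (b - rk F i))\<rparr>"

definition join :: "nat \<Rightarrow> (nat \<Rightarrow> ('v, 'k::field) mpoly) \<Rightarrow> (nat \<Rightarrow> ('v, 'k) mpoly) \<Rightarrow> nat \<Rightarrow> ('v, 'k) mpoly" where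
  "join n u v = (\<lambda>a. if a < n then u a else v (a - n))"

lemma rk_cone_0: "rk (cone p F) 0 = rk F 0"
  by (simp add: cone_def cone_rk_def)

lemma rk_cone_Suc: "rk (cone p F) (Suc n) = rk F (Suc n) + rk F n"
  by (simp add: cone_def cone_rk_def)

text \<open>The vanishing assumption is stated separately because \<open>join\<close> discards the
  entries of \<open>u\<close> beyond the rank.\<close>

lemma join_chains_iff:
  assumes "\<And>a. a \<ge> rk F (Suc n) \<Longrightarrow> u a = 0"
  shows "join (rk F (Suc n)) u v \<in> chains (cone p F) UNIV (Suc n) j \<longleftrightarrow>
    u \<in> chains F UNIV (Suc n) j \<and> v \<in> chains F UNIV n (j - 1)"
proof
  assume L: "join (rk F (Suc n)) u v \<in> chains (cone p F) UNIV (Suc n) j"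
  have "homogeneous (j - shift F (Suc n) a) (u a)" if "a < rk F (Suc n)" for a
  proof -
    have "homogeneous (j - shift (cone p F) (Suc n) a) (join (rk F (Suc n)) u v a)"
      using L that by (simp add: chains_def rk_cone_Suc)
    then show ?thesis using that by (simp add: join_def cone_def)
  qed
  moreover have "homogeneous (j - 1 - shift F n a) (v a)" if "a < rk F n" for a
  proof -
    have "homogeneous (j - shift (cone p F) (Suc n) (rk F (Suc n) + a)) (join (rk F (Suc n)) u v (rk F (Suc n) + a))"
      using L that by (simp add: chains_def rk_cone_Suc)
    then show ?thesis by (simp add: join_def cone_def algebra_simps)
  qed
  moreover have "v a = 0" if "a \<ge> rk F n" for a
  proof -
    have "join (rk F (Suc n)) u v (rk F (Suc n) + a) = 0"
      using L that by (simp add: chains_def rk_cone_Suc)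
    then show ?thesis by (simp add: join_def)
  qed
  ultimately show "u \<in> chains F UNIV (Suc n) j \<and> v \<in> chains F UNIV n (j - 1)"
    using assms by (simp add: chains_def)
next
  assume R: "u \<in> chains F UNIV (Suc n) j \<and> v \<in> chains F UNIV n (j - 1)"
  show "join (rk F (Suc n)) u v \<in> chains (cone p F) UNIV (Suc n) j"
  proof (rule chainsI)
    fix a assume a: "a < rk (cone p F) (Suc n)"
    show "homogeneous (j - shift (cone p F) (Suc n) a) (join (rk F (Suc n)) u v a)"
    proof (cases "a < rk F (Suc n)")
      case True
      then show ?thesis using R by (simp add: chains_def join_def cone_def)
    next
      case False
      then have "homogeneous (j - 1 - shift F n (a - rk F (Suc n))) (v (a - rk F (Suc n)))"
        using R a by (auto simp: chains_def rk_cone_Suc)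
      then show ?thesis
        using False by (simp add: join_def cone_def algebra_simps)
    qed
  qed (use R in \<open>auto simp: chains_def join_def rk_cone_Suc\<close>)
qed

lemma cone_chain_split:
  assumes "w \<in> chains (cone p F) UNIV (Suc n) j"
  obtains u v where "u \<in> chains F UNIV (Suc n) j" "v \<in> chains F UNIV n (j - 1)" "w = join (rk F (Suc n)) u v"
proof -
  define u v where "u = (\<lambda>a. if a < rk F (Suc n) then w a else 0)" and "v = (\<lambda>a. w (rk F (Suc n) + a))"
  have w: "w = join (rk F (Suc n)) u v"
    by (auto simp: join_def u_def v_def fun_eq_iff)
  have "u \<in> chains F UNIV (Suc n) j \<and> v \<in> chains F UNIV n (j - 1)"
    using assms unfolding w by (subst (asm) join_chains_iff) (auto simp: u_def)
  then show ?thesis using that w by blast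
qed

lemma chains_cone_0: "chains (cone p F) UNIV 0 j = chains F UNIV 0 j"
  by (auto simp: chains_def rk_cone_0) (auto simp: cone_def)

lemma sum_lessThan_add: "(\<Sum>a<m + n. f a) = (\<Sum>a<m. f a) + (\<Sum>a<n. f (m + a :: nat) :: 'a::comm_monoid_add)"
  by (induction n) (simp_all add: add.assoc)

lemma bd_cone_0:
  assumes "v \<in> chains F UNIV 0 j"
  shows "bd (cone p F) (Suc 0) (join (rk F (Suc 0)) u v) = bd F (Suc 0) u + smul p v"
proof
  fix b
  show "bd (cone p F) (Suc 0) (join (rk F (Suc 0)) u v) b = (bd F (Suc 0) u + smul p v) b"
  proof (cases "b < rk F 0")
    case True
    have "(\<Sum>a<rk F 0. v a * (if b = a then p else 0)) = p * v b"
      using True by (simp add: if_distrib[of "\<lambda>x. _ * x"] mult.commute cong: if_cong)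
    then show ?thesis
      using True by (simp add: bd_Suc rk_cone_0 rk_cone_Suc sum_lessThan_add join_def smul_def cone_def cone_rk_def)
  next
    case False
    then show ?thesis
      using assms by (simp add: bd_Suc rk_cone_0 smul_def chains_def)
  qed
qed

lemma bd_cone_Suc:
  assumes "v \<in> chains F UNIV (Suc n) j"
  shows "bd (cone p F) (Suc (Suc n)) (join (rk F (Suc (Suc n))) u v) =
    join (rk F (Suc n)) (bd F (Suc (Suc n)) u + smul p v) (- bd F (Suc n) v)"
proof
  fix b
  show "bd (cone p F) (Suc (Suc n)) (join (rk F (Suc (Suc n))) u v) b =
    join (rk F (Suc n)) (bd F (Suc (Suc n)) u + smul p v) (- bd F (Suc n) v) b"
  proof (cases "b < rk F (Suc n)")
    case True
    have "(\<Sum>a<rk F (Suc n). v a * (if b = a then p else 0)) = p * v b"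
      using True by (simp add: if_distrib[of "\<lambda>x. _ * x"] mult.commute cong: if_cong)
    then show ?thesis
      using True by (simp add: bd_Suc rk_cone_Suc sum_lessThan_add join_def smul_def cone_def cone_rk_def)
  next
    case False
    then show ?thesis
      by (auto simp: bd_Suc rk_cone_Suc sum_lessThan_add join_def cone_def cone_rk_def sum_negf)
  qed
qed

text \<open>The induction invariant for building the Koszul complex: \<open>F\<close> resolves the
  quotient of \<open>S\<close> by the variables in \<open>B\<close>, with \<open>S\<close> itself in
  homological degree 0.\<close>

definition resolves_vars :: "('v::finite, 'k::field) free_complex \<Rightarrow> 'v set \<Rightarrow> bool" where
  "resolves_vars F B \<longleftrightarrow> rk F 0 = 1 \<and> shift F 0 0 = 0 \<and> graded_complex F \<and>
    (\<forall>i j. cycles F UNIV (Suc i) j = boundaries F UNIV (Suc i) j) \<and>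
    (\<forall>j. boundaries F UNIV 0 j = {u \<in> chains F UNIV 0 j. u 0 \<in> sqf ((\<lambda>x. {x}) ` B)})"

lemma graded_cone:
  assumes "graded_complex F" and "rk F 0 = 1"
  shows "graded_complex (cone (sqmon {x}) F)"
proof (intro allI impI)
  fix i a b assume ab: "a < rk (cone (sqmon {x}) F) (Suc i)" "b < rk (cone (sqmon {x}) F) i"
  let ?G = "\<lambda>i a b. homogeneous (shift F (Suc i) a - shift F i b) (mat F i a b)"
  have g: "?G i a b" if "a < rk F (Suc i)" "b < rk F i" for i a b
    using assms(1) that by blast
  have x: "homogeneous 1 (sqmon {x} :: ('a, 'b) mpoly)"
    using homogeneous_sqmon[of "{x}"] by simp
  show "homogeneous (shift (cone (sqmon {x}) F) (Suc i) a - shift (cone (sqmon {x}) F) i b)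
      (mat (cone (sqmon {x}) F) i a b)"
  proof (cases "a < rk F (Suc i)")
    case True
    then show ?thesis
      using g[of a i b] by (simp add: cone_def homogeneous_0)
  next
    case a: False
    show ?thesis
    proof (cases "b < rk F i")
      case True
      then show ?thesis
        using a x by (auto simp: cone_def homogeneous_0)
    next
      case False
      then obtain n where n: "i = Suc n"
        using ab(2) by (cases i) (auto simp: rk_cone_0)
      then have "?G n (a - rk F (Suc i)) (b - rk F i)"
        using a False ab by (intro g) (auto simp: rk_cone_Suc)
      then show ?thesis
        using a False n by (simp add: cone_def homogeneous_uminus)
    qed
  qed
qed

lemma join_eq_iff:
  assumes "\<And>a. a \<ge> n \<Longrightarrow> u a = 0" "\<And>a. a \<ge> n \<Longrightarrow> u' a = 0"
  shows "join n u v = join n u' v' \<longleftrightarrow> u = u' \<and> v = v'"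
proof
  assume eq: "join n u v = join n u' v'"
  have "u a = u' a" for a
    using fun_cong[OF eq, of a] assms by (cases "a < n") (auto simp: join_def)
  moreover have "v a = v' a" for a
    using fun_cong[OF eq, of "n + a"] by (simp add: join_def)
  ultimately show "u = u' \<and> v = v'" by auto
qed simp

lemma bd_uminus: "bd F i (- u) = - bd F i u"
  using bd_diff[of F i 0 u] by (simp add: bd_zero)

lemma smul_uminus: "smul p (- u) = - smul p u"
  by (simp add: smul_def fun_eq_iff)

lemma join_0: "join n 0 0 = 0"
  by (auto simp: join_def)

lemma sqf_vars_insert:
  assumes "w \<in> chains F UNIV 0 j" "rk F 0 = 1" "shift F 0 0 = 0" "w 0 \<in> sqf (insert {x} A)"
  obtains w1 w2 where "w = w1 + smul (sqmon {x}) w2" "w1 \<in> chains F UNIV 0 j" "w1 0 \<in> sqf A" "w2 \<in> chains F UNIV 0 (j - 1)"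
proof -
  have "w \<in> chains F (sqf (insert {x} A)) 0 j"
    using assms by (simp add: chains_def)
  then obtain w1 w2 where "w1 \<in> chains F (sqf A) 0 j" "w2 \<in> chains F UNIV 0 (j - int (card {x}))"
    "w = w1 + smul (sqmon {x}) w2"
    by (rule chains_insert_split)
  then show ?thesis
    using that[of w1 w2] assms(2) by (auto simp: chains_def)
qed

text \<open>A variable outside \<open>B\<close> is a nonzerodivisor modulo the variables of
  \<open>B\<close>, so the cone of multiplication by it resolves the quotient by one more variable.
  The nonzerodivisor property is the local fact \<open>colon\<close>.\<close>

lemma cone_resolves:
  fixes F :: "('v::finite, 'k::field) free_complex"
  assumes F: "resolves_vars F B" and x: "x \<notin> B"
  shows "resolves_vars (cone (sqmon {x}) F) (insert x B)"
proof -
  let ?p = "sqmon {x} :: ('v, 'k) mpoly" and ?V = "(\<lambda>x. {x}) ` B"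
  let ?C = "cone ?p F"
  have rk0: "rk F 0 = 1" and sh0: "shift F 0 0 = 0" and gr: "graded_complex F"
    and ex: "\<And>i j. cycles F UNIV (Suc i) j = boundaries F UNIV (Suc i) j"
    and ex0: "\<And>j. boundaries F UNIV 0 j = {u \<in> chains F UNIV 0 j. u 0 \<in> sqf ?V}"
    using F by (auto simp: resolves_vars_def)
  have colon: "colon ?V {x} = ?V"
    by (rule colon_disjoint) (use x in auto)
  have bd_bd: "bd F (Suc i) (bd F (Suc (Suc i)) u) = 0" if "u \<in> chains F UNIV (Suc (Suc i)) j" for u i j
  proof -
    have "bd F (Suc (Suc i)) u \<in> cycles F UNIV (Suc i) j"
      using that unfolding ex by (auto simp: boundaries_iff)
    then show ?thesis by (simp add: cycles_iff)
  qed
  have smul: "smul ?p v \<in> chains F UNIV i j" if "v \<in> chains F UNIV i (j - 1)" for v i j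
    using that smul_sqmon_chains[of v F i j "{x}" "{{x}}"] by (auto intro: chains_UNIV)
  have vanish: "\<And>a. a \<ge> rk F i \<Longrightarrow> u a = 0" if "u \<in> chains F UNIV i j" for u i j
    using that by (simp add: chains_def)
  \<comment> \<open>In homological degree 1 a cycle \<open>(u, v)\<close> satisfies
    \<open>p v = -du\<close>. So \<open>p v\<close> lies in the ideal of \<open>B\<close>, hence so
    does \<open>v\<close>, and \<open>v\<close> bounds.\<close>
  have cyc0: "w \<in> boundaries ?C UNIV (Suc 0) j" if w: "w \<in> cycles ?C UNIV (Suc 0) j" for w j
  proof -
    obtain u v where uv: "u \<in> chains F UNIV (Suc 0) j" "v \<in> chains F UNIV 0 (j - 1)" "w = join (rk F (Suc 0)) u v"
      using w by (auto simp: cycles_iff elim: cone_chain_split)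
    have 0: "bd F (Suc 0) u + smul ?p v = 0"
      using w uv by (simp add: cycles_iff bd_cone_0[OF uv(2)])
    have "0 - bd F (Suc 0) u \<in> boundaries F UNIV 0 j"
      using uv(1) by (auto simp: boundaries_iff bd_uminus intro!: bexI[of _ "- u"])
        (metis chains_UNIV_diff chains_0[of F "{{}}", unfolded sqf_top] diff_0)
    moreover have "smul ?p v = 0 - bd F (Suc 0) u"
      using 0 by (metis add_diff_cancel_left')
    ultimately have "smul ?p v \<in> boundaries F UNIV 0 j" by metis
    then have "v 0 \<in> sqf ?V"
      unfolding ex0 by (simp add: smul_def sqmon_mult_mem_sqf_iff colon)
    then have "v \<in> boundaries F UNIV 0 (j - 1)"
      unfolding ex0 using uv(2) by simp
    then obtain v' where v': "v' \<in> chains F UNIV (Suc 0) (j - 1)" "v = bd F (Suc 0) v'"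
      by (auto simp: boundaries_iff)
    have "u + smul ?p v' \<in> cycles F UNIV (Suc 0) j"
      using 0 v' uv(1) by (simp add: cycles_iff bd_add bd_smul chains_UNIV_add smul)
    then obtain u' where u': "u' \<in> chains F UNIV (Suc (Suc 0)) j" "u + smul ?p v' = bd F (Suc (Suc 0)) u'"
      unfolding ex by (auto simp: boundaries_iff)
    \<comment> \<open>The sign compensates for the negated differential on the second summand of the
      cone.\<close>
    have nv': "0 - v' \<in> chains F UNIV (Suc 0) (j - 1)"
      using v'(1) by (intro chains_UNIV_diff chains_0[of F "{{}}", unfolded sqf_top])
    have "join (rk F (Suc (Suc 0))) u' (0 - v') \<in> chains ?C UNIV (Suc (Suc 0)) j"
      using u'(1) nv' vanish by (subst join_chains_iff) auto
    moreover have "w = bd ?C (Suc (Suc 0)) (join (rk F (Suc (Suc 0))) u' (0 - v'))"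
      unfolding bd_cone_Suc[OF nv'] uv(3) bd_diff bd_zero u'(2)[symmetric] smul_diff smul_0
      by (simp add: v'(2))
    ultimately show ?thesis by (auto simp: boundaries_iff)
  qed
  \<comment> \<open>In higher degrees \<open>v\<close> is itself a cycle, so exactness of
    \<open>F\<close> replaces the nonzerodivisor argument.\<close>
  have cycSuc: "w \<in> boundaries ?C UNIV (Suc (Suc n)) j" if w: "w \<in> cycles ?C UNIV (Suc (Suc n)) j" for w j n
  proof -
    obtain u v where uv: "u \<in> chains F UNIV (Suc (Suc n)) j" "v \<in> chains F UNIV (Suc n) (j - 1)"
      "w = join (rk F (Suc (Suc n))) u v"
      using w by (auto simp: cycles_iff elim: cone_chain_split)
    have "bd F (Suc (Suc n)) u + smul ?p v \<in> chains F UNIV (Suc n) j"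
      using uv gr by (intro chains_UNIV_add smul bd_chains_UNIV)
    then have van: "a \<ge> rk F (Suc n) \<Longrightarrow> (bd F (Suc (Suc n)) u + smul ?p v) a = 0" for a
      by (rule vanish)
    have "join (rk F (Suc n)) (bd F (Suc (Suc n)) u + smul ?p v) (- bd F (Suc n) v) = join (rk F (Suc n)) 0 0"
      using w uv by (simp add: cycles_iff bd_cone_Suc[OF uv(2)] join_0)
    then have 0: "bd F (Suc (Suc n)) u + smul ?p v = 0" "bd F (Suc n) v = 0"
      using van by (subst (asm) join_eq_iff; simp)+
    have "v \<in> boundaries F UNIV (Suc n) (j - 1)"
      unfolding ex[symmetric] using uv(2) 0 by (simp add: cycles_iff)
    then obtain v' where v': "v' \<in> chains F UNIV (Suc (Suc n)) (j - 1)" "v = bd F (Suc (Suc n)) v'"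
      by (auto simp: boundaries_iff)
    have "u + smul ?p v' \<in> cycles F UNIV (Suc (Suc n)) j"
      using 0 v' uv(1) by (simp add: cycles_iff bd_add bd_smul chains_UNIV_add smul)
    then obtain u' where u': "u' \<in> chains F UNIV (Suc (Suc (Suc n))) j" "u + smul ?p v' = bd F (Suc (Suc (Suc n))) u'"
      unfolding ex by (auto simp: boundaries_iff)
    have nv': "0 - v' \<in> chains F UNIV (Suc (Suc n)) (j - 1)"
      using v'(1) by (intro chains_UNIV_diff chains_0[of F "{{}}", unfolded sqf_top])
    have "join (rk F (Suc (Suc (Suc n)))) u' (0 - v') \<in> chains ?C UNIV (Suc (Suc (Suc n))) j"
      using u'(1) nv' vanish by (subst join_chains_iff) auto
    moreover have "w = bd ?C (Suc (Suc (Suc n))) (join (rk F (Suc (Suc (Suc n)))) u' (0 - v'))"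
      unfolding bd_cone_Suc[OF nv'] uv(3) bd_diff bd_zero u'(2)[symmetric] smul_diff smul_0
      by (simp add: v'(2))
    ultimately show ?thesis by (auto simp: boundaries_iff)
  qed
  \<comment> \<open>The differential of the cone squares to zero since the two terms
    \<open>p dv\<close> cancel; the lowest degree is separate because its target has no second
    summand.\<close>
  have bou0: "w \<in> cycles ?C UNIV (Suc 0) j" if w: "w \<in> boundaries ?C UNIV (Suc 0) j" for w j
  proof -
    obtain u v where uv: "u \<in> chains F UNIV (Suc (Suc 0)) j" "v \<in> chains F UNIV (Suc 0) (j - 1)"
      "w = bd ?C (Suc (Suc 0)) (join (rk F (Suc (Suc 0))) u v)"
      using w by (auto simp: boundaries_iff elim: cone_chain_split)
    have c: "bd F (Suc (Suc 0)) u + smul ?p v \<in> chains F UNIV (Suc 0) j"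
      using uv gr by (intro chains_UNIV_add smul bd_chains_UNIV)
    have d: "- bd F (Suc 0) v \<in> chains F UNIV 0 (j - 1)"
      using chains_UNIV_diff[OF chains_0[of F "{{}}", unfolded sqf_top] bd_chains_UNIV[OF gr uv(2)]] by simp
    show ?thesis
      unfolding cycles_iff uv(3) bd_cone_Suc[OF uv(2)] bd_cone_0[OF d]
      using c d vanish[OF c] bd_bd[OF uv(1)]
      by (subst join_chains_iff) (auto simp: bd_add bd_smul, auto simp: smul_def fun_eq_iff)
  qed
  have bouSuc: "w \<in> cycles ?C UNIV (Suc (Suc n)) j" if w: "w \<in> boundaries ?C UNIV (Suc (Suc n)) j" for w j n
  proof -
    obtain u v where uv: "u \<in> chains F UNIV (Suc (Suc (Suc n))) j" "v \<in> chains F UNIV (Suc (Suc n)) (j - 1)"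
      "w = bd ?C (Suc (Suc (Suc n))) (join (rk F (Suc (Suc (Suc n)))) u v)"
      using w by (auto simp: boundaries_iff elim: cone_chain_split)
    have c: "bd F (Suc (Suc (Suc n))) u + smul ?p v \<in> chains F UNIV (Suc (Suc n)) j"
      using uv gr by (intro chains_UNIV_add smul bd_chains_UNIV)
    have d: "- bd F (Suc (Suc n)) v \<in> chains F UNIV (Suc n) (j - 1)"
      using chains_UNIV_diff[OF chains_0[of F "{{}}", unfolded sqf_top] bd_chains_UNIV[OF gr uv(2)]] by simp
    have neg: "bd F (Suc n) (- bd F (Suc (Suc n)) v) = 0"
      using bd_diff[of F "Suc n" 0 "bd F (Suc (Suc n)) v"] bd_bd[OF uv(2)] by (simp add: bd_zero)
    have "bd F (Suc (Suc n)) (bd F (Suc (Suc (Suc n))) u + smul ?p v) + smul ?p (- bd F (Suc (Suc n)) v) = 0"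
      using bd_bd[OF uv(1)] by (simp add: bd_add bd_smul smul_uminus)
    then show ?thesis
      unfolding cycles_iff uv(3) bd_cone_Suc[OF uv(2)] bd_cone_Suc[OF d]
      using c d vanish[OF c] neg
      by (subst join_chains_iff) (auto simp: join_0)
  qed
  have "cycles ?C UNIV (Suc i) j = boundaries ?C UNIV (Suc i) j" for i j
    using cyc0 cycSuc bou0 bouSuc by (cases i) blast+
  \<comment> \<open>The image in degree 0 is the old ideal plus the multiples of the new
    variable.\<close>
  moreover have "boundaries ?C UNIV 0 j = {u \<in> chains ?C UNIV 0 j. u 0 \<in> sqf (insert {x} ?V)}" for j
  proof (intro equalityI subsetI)
    fix w assume "w \<in> boundaries ?C UNIV 0 j"
    then obtain u v where uv: "u \<in> chains F UNIV (Suc 0) j" "v \<in> chains F UNIV 0 (j - 1)"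
      "w = bd ?C (Suc 0) (join (rk F (Suc 0)) u v)"
      by (auto simp: boundaries_iff elim: cone_chain_split)
    have w: "w = bd F (Suc 0) u + smul ?p v"
      using uv bd_cone_0 by blast
    have "bd F (Suc 0) u \<in> boundaries F UNIV 0 j"
      using uv(1) by (auto simp: boundaries_iff)
    then have "bd F (Suc 0) u \<in> chains F UNIV 0 j" "bd F (Suc 0) u 0 \<in> sqf ?V"
      unfolding ex0 by auto
    moreover have "sqf ?V \<subseteq> (sqf (insert {x} ?V) :: ('v, 'k) mpoly set)"
      by (rule sqf_subset) auto
    moreover have "smul ?p v 0 \<in> sqf (insert {x} ?V)"
      unfolding smul_def mult.commute[of ?p] by (intro sqf_mult sqmon_in_sqf) simp
    ultimately show "w \<in> {u \<in> chains ?C UNIV 0 j. u 0 \<in> sqf (insert {x} ?V)}"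
      using uv(2) unfolding w chains_cone_0 by (auto intro!: chains_UNIV_add smul sqf_add)
  next
    fix w assume "w \<in> {u \<in> chains ?C UNIV 0 j. u 0 \<in> sqf (insert {x} ?V)}"
    then have "w \<in> chains F UNIV 0 j" "w 0 \<in> sqf (insert {x} ?V)"
      by (auto simp: chains_cone_0)
    then obtain w1 w2 where w: "w = w1 + smul ?p w2" "w1 \<in> chains F UNIV 0 j" "w1 0 \<in> sqf ?V"
      "w2 \<in> chains F UNIV 0 (j - 1)"
      using rk0 sh0 by (blast elim: sqf_vars_insert)
    then have "w1 \<in> boundaries F UNIV 0 j"
      unfolding ex0 by simp
    then obtain u where u: "u \<in> chains F UNIV (Suc 0) j" "w1 = bd F (Suc 0) u"
      by (auto simp: boundaries_iff)
    have "join (rk F (Suc 0)) u w2 \<in> chains ?C UNIV (Suc 0) j"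
      using u(1) w(4) vanish by (subst join_chains_iff) auto
    moreover have "w = bd ?C (Suc 0) (join (rk F (Suc 0)) u w2)"
      by (simp add: bd_cone_0[OF w(4)] w(1) u(2))
    ultimately show "w \<in> boundaries ?C UNIV 0 j"
      by (auto simp: boundaries_iff)
  qed
  ultimately show ?thesis
    using graded_cone[OF gr rk0] rk0 sh0
    by (simp add: resolves_vars_def rk_cone_0) (simp add: cone_def)
qed

lemma resolves_vars_empty: "\<exists>F :: ('v::finite, 'k::field) free_complex. resolves_vars F {}"
proof
  let ?F = "\<lparr>rk = (\<lambda>i. if i = 0 then 1 else 0), shift = (\<lambda>_ _. 0), mat = (\<lambda>_ _ _. 0)\<rparr> :: ('v, 'k) free_complex"
  have chains: "chains ?F UNIV (Suc i) j = {0}" for i j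
    by (auto simp: chains_def fun_eq_iff homogeneous_0)
  have boundaries: "boundaries ?F UNIV i j = {0}" for i j
    by (simp add: boundaries_def chains bd_zero)
  have cycles: "cycles ?F UNIV (Suc i) j = {0}" for i j
    by (rule set_eqI) (unfold cycles_iff chains, simp, metis bd_zero)
  have "u = 0" if "u \<in> chains ?F UNIV 0 j" "u 0 = 0" for u j
  proof
    show "u a = 0 a" for a
      using that by (cases a) (auto simp: chains_def)
  qed
  moreover have "0 \<in> chains ?F UNIV 0 j" for j
    using chains_0[of ?F "{{}}"] by (simp add: sqf_top)
  ultimately show "resolves_vars ?F {}"
    by (auto simp: resolves_vars_def cycles boundaries sqf_empty)
qed

text \<open>Start from \<open>S\<close> alone and take cones over all variables. The ideal of all
  variables consists of the polynomials without constant term, which is the kernel of the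
  augmentation with weight 1.\<close>

lemma resolution_exists: "\<exists>F :: ('v::finite, 'k::field) free_complex. graded_free_resolution_of_k F"
proof -
  have "\<exists>F :: ('v, 'k) free_complex. resolves_vars F B" for B
    by (induction B rule: finite_induct[OF finite]) (auto intro: resolves_vars_empty cone_resolves)
  then obtain F :: "('v, 'k) free_complex" where F: "resolves_vars F UNIV" by blast
  have mem: "p \<in> sqf (range (\<lambda>x. {x})) \<longleftrightarrow> Poly_Mapping.lookup p 0 = 0" for p :: "('v, 'k) mpoly"
  proof -
    have "p \<in> sqf (range (\<lambda>x. {x})) \<longleftrightarrow> (\<forall>m\<in>Poly_Mapping.keys p. Poly_Mapping.keys m \<noteq> {})"
      by (auto simp: sqf_def simp del: keys_eq_empty)
    also have "\<dots> \<longleftrightarrow> 0 \<notin> Poly_Mapping.keys p" by auto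
    finally show ?thesis by (simp add: in_keys_iff)
  qed
  have aug: "augmentation F (\<lambda>_. 1) u = Poly_Mapping.lookup (u 0) 0" for u
    using F by (simp add: augmentation_def resolves_vars_def)
  have "augmentation F (\<lambda>_. 1) ` chains F UNIV 0 0 = UNIV"
  proof (intro equalityI subsetI)
    fix c :: 'k
    have "(\<lambda>a. if a = 0 then Poly_Mapping.single 0 c else 0) \<in> chains F UNIV 0 0"
      using F by (auto simp: chains_def resolves_vars_def homogeneous_iff mdeg_def split: if_splits)
    then show "c \<in> augmentation F (\<lambda>_. 1) ` chains F UNIV 0 0"
      by (rule image_eqI[rotated]) (simp add: aug)
  qed simp
  then have "graded_free_resolution_of_k F"
    using F unfolding graded_free_resolution_of_k_def
    by (intro conjI exI[of _ "\<lambda>_. 1"]) (auto simp: resolves_vars_def aug mem)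
  then show ?thesis ..
qed

section \<open>Regularity bounds for squarefree monomial ideals\<close>

text \<open>A bound on Tor rather than on \<open>reg\<close>, so the convention for the zero ideal
  does not interfere with splittings. The first argument only fixes the field, which
  \<open>A\<close> does not determine.\<close>

definition reg_le :: "'k::field itself \<Rightarrow> 'v::finite set set \<Rightarrow> ereal \<Rightarrow> bool" where
  "reg_le _ A b \<longleftrightarrow> (\<forall>i j. Tor_nonzero (sqf A :: ('v, 'k) mpoly set) i j \<longrightarrow> ereal (of_int (j - int i)) \<le> b)"

lemma reg_le_mono: "reg_le K A b \<Longrightarrow> b \<le> c \<Longrightarrow> reg_le K A c"
  unfolding reg_le_def by (meson order_trans)

lemma reg_le_empty: "reg_le (K :: 'k::field itself) ({} :: 'v::finite set set) b"
proof -
  have "u \<in> boundaries F (sqf {}) i j" if "u \<in> chains F (sqf {}) i j"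
    for F :: "('v, 'k) free_complex" and u i j
  proof -
    have "u a = 0" for a
      using that by (cases "a < rk F i") (auto simp: chains_def sqf_empty)
    then have "u = bd F (Suc i) 0"
      by (simp add: bd_zero fun_eq_iff)
    then show ?thesis
      by (auto simp: boundaries_iff intro!: bexI[of _ 0] chains_0)
  qed
  then show ?thesis
    by (auto simp: reg_le_def Tor_nonzero_iff cycles_iff)
qed

lemma reg_le_colon:
  assumes "reg_le K (insert T A) b" and "reg_le K (colon A T) c" and "c + ereal (card T) \<le> b"
  shows "reg_le (K :: 'k::field itself) (A :: 'v::finite set set) b"
  unfolding reg_le_def
proof (intro allI impI)
  fix i j assume "Tor_nonzero (sqf A :: ('v, 'k) mpoly set) i j"
  from Tor_colon_or_insert[OF this, of T] show "ereal (of_int (j - int i)) \<le> b"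
  proof
    assume "Tor_nonzero (sqf (colon A T) :: ('v, 'k) mpoly set) i (j - int (card T))"
    then have "ereal (of_int (j - int (card T) - int i)) \<le> c"
      using assms(2) by (simp only: reg_le_def)
    then have "ereal (of_int (j - int (card T) - int i)) + ereal (card T) \<le> c + ereal (card T)"
      by (rule add_right_mono)
    then show ?thesis
      using assms(3) by (simp add: order_trans)
  qed (use assms(1) in \<open>simp only: reg_le_def\<close>)
qed

text \<open>The connecting map lowers the homological degree by one, which turns the shift by
  \<open>card T\<close> into \<open>card T - 1\<close>. The last assumption accounts for the
  generator itself.\<close>

lemma reg_le_insert:
  assumes "reg_le K A b" and "reg_le K (colon A T) c" and "c + ereal (real (card T) - 1) \<le> b"
    and "ereal (card T) \<le> b"
  shows "reg_le (K :: 'k::field itself) (insert T A :: 'v::finite set set) b"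
  unfolding reg_le_def
proof (intro allI impI)
  fix i j assume "Tor_nonzero (sqf (insert T A) :: ('v, 'k) mpoly set) i j"
  from Tor_insert_cases[OF this] consider "Tor_nonzero (sqf A :: ('v, 'k) mpoly set) i j"
    | "i = 0" "j = int (card T)"
    | n where "i = Suc n" "Tor_nonzero (sqf (colon A T) :: ('v, 'k) mpoly set) n (j - int (card T))"
    by blast
  then show "ereal (of_int (j - int i)) \<le> b"
  proof cases
    case 1
    then show ?thesis using assms(1) by (simp only: reg_le_def)
  next
    case 2
    then show ?thesis using assms(4) by simp
  next
    case 3
    then have "ereal (of_int (j - int (card T) - int n)) \<le> c"
      using assms(2) by (simp only: reg_le_def)
    then have "ereal (of_int (j - int (card T) - int n)) + ereal (real (card T) - 1) \<le> c + ereal (real (card T) - 1)"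
      by (rule add_right_mono)
    then show ?thesis
      using assms(3) 3(1) by (simp add: order_trans algebra_simps)
  qed
qed

lemma reg_le_restrict:
  assumes "reg_le K A b" and "B = {S \<in> A. S \<subseteq> W}"
  shows "reg_le K B b"
  using assms Tor_restrict unfolding reg_le_def by blast

text \<open>Generators meeting \<open>U\<close> are redundant beside the variables of
  \<open>U\<close>. Adding a variable absent from all generators leaves the colon ideal unchanged
  and shifts by \<open>1 - 1 = 0\<close>.\<close>

lemma reg_le_vars:
  assumes "reg_le K {S \<in> A. S \<inter> U = {}} b" and "1 \<le> b" and "\<And>x. x \<in> U \<Longrightarrow> {x} \<in> A"
  shows "reg_le (K :: 'k::field itself) (A :: 'v::finite set set) b"
proof -
  let ?B = "{S \<in> A. S \<inter> U = {}}"
  have "reg_le K ((\<lambda>x. {x}) ` V \<union> ?B) b" if "V \<subseteq> U" for V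
    using finite[of V] that
  proof (induction V rule: finite_induct)
    case (insert x V)
    have "colon ((\<lambda>x. {x}) ` V \<union> ?B) {x} = (\<lambda>x. {x}) ` V \<union> ?B"
      by (rule colon_disjoint) (use insert in auto)
    then have "reg_le K (insert {x} ((\<lambda>x. {x}) ` V \<union> ?B)) b"
      using insert assms(2) by (intro reg_le_insert[where c = b]) (auto simp: one_ereal_def zero_ereal_def[symmetric])
    then show ?case by simp
  qed (use assms(1) in simp)
  then have *: "reg_le K ((\<lambda>x. {x}) ` U \<union> ?B) b" by blast
  have "\<exists>S'\<in>(\<lambda>x. {x}) ` U \<union> ?B. S' \<subseteq> S" if "S \<in> A" for S
  proof (cases "S \<inter> U = {}")
    case False
    then obtain x where "x \<in> S" "x \<in> U" by auto
    then show ?thesis by (intro bexI[of _ "{x}"]) auto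
  qed (use that in auto)
  then have "sqf A = (sqf ((\<lambda>x. {x}) ` U \<union> ?B) :: ('v, 'k) mpoly set)"
    using assms(3) by (intro sqf_cong) auto
  then show ?thesis
    using * by (simp only: reg_le_def)
qed

lemma reg_le_insert_disjoint:
  assumes "reg_le K (insert T A) b" and "T \<noteq> {}" "\<And>S. S \<in> A \<Longrightarrow> S \<inter> T = {}" "{} \<notin> A"
  shows "reg_le (K :: 'k::field itself) (A :: 'v::finite set set) (b - ereal (real (card T) - 1))"
  unfolding reg_le_def
proof (intro allI impI)
  fix i j assume "Tor_nonzero (sqf A :: ('v, 'k) mpoly set) i j"
  from Tor_insert_disjoint[OF this assms(2-4)]
  have "ereal (of_int (j + int (card T) - int (Suc i))) \<le> b"
    using assms(1) by (simp only: reg_le_def)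
  then show "ereal (of_int (j - int i)) \<le> b - ereal (real (card T) - 1)"
    by (simp add: ereal_le_minus algebra_simps)
qed

text \<open>For a minimal generator \<open>T\<close>, restricting to the variables in
  \<open>T\<close> leaves a principal ideal, whose Tor in homological degree 0 is nonzero.\<close>

lemma card_le_reg_le:
  assumes "reg_le (K :: 'k::field itself) (A :: 'v::finite set set) b" and "T \<in> A"
    and "\<And>S. S \<in> A \<Longrightarrow> S \<subseteq> T \<Longrightarrow> S = T"
  shows "ereal (card T) \<le> b"
proof -
  obtain F :: "('v, 'k) free_complex" where F: "graded_free_resolution_of_k F"
    using resolution_exists by blast
  have "{T} = {S \<in> A. S \<subseteq> T}"
    using assms(2,3) by auto
  from reg_le_restrict[OF assms(1) this] show ?thesis
    using Tor_singleton[OF F, of T] by (force simp: reg_le_def)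
qed

text \<open>Generators of the edge ideal of the complete graph on \<open>Z\<close>.\<close>

definition pairs :: "'v set \<Rightarrow> 'v set set" where
  "pairs Z = {{u, v} | u v. u \<in> Z \<and> v \<in> Z \<and> u \<noteq> v}"

text \<open>Induction on \<open>Z\<close>, splitting at a new vertex \<open>z\<close>: adding the
  variable \<open>z\<close> removes all pairs through it, while the colon by \<open>z\<close> turns
  the rest of \<open>Z\<close> into variables and leaves only \<open>A\<close>.\<close>

lemma reg_le_pairs:
  assumes "reg_le K A c" and "1 \<le> c" and "c + 1 \<le> b" and "\<And>S. S \<in> A \<Longrightarrow> S \<inter> Z = {}"
  shows "reg_le (K :: 'k::field itself) (A \<union> pairs Z :: 'v::finite set set) b"
proof -
  have cb: "c \<le> b"
    using assms(3) by (cases c; cases b) (auto simp: one_ereal_def)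
  show ?thesis
    using finite[of Z] assms(4)
  proof (induction Z rule: finite_induct)
    case empty
    then show ?case using reg_le_mono[OF assms(1) cb] by (simp add: pairs_def)
  next
    case (insert z Z)
    let ?B = "A \<union> pairs (insert z Z)"
    have 1: "reg_le K (insert {z} ?B) b"
    proof (rule reg_le_vars[where U = "{z}"])
      have "{S \<in> insert {z} ?B. S \<inter> {z} = {}} = A \<union> pairs Z"
        using insert.prems insert.hyps by (auto simp: pairs_def)
      then show "reg_le K {S \<in> insert {z} ?B. S \<inter> {z} = {}} b"
        using insert by simp
    qed (use assms(2) cb in auto)
    have 2: "reg_le K (colon ?B {z}) c"
    proof (rule reg_le_vars[where U = Z])
      have "{S \<in> colon ?B {z}. S \<inter> Z = {}} = A"
      proof (intro equalityI subsetI)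
        fix S assume "S \<in> {S \<in> colon ?B {z}. S \<inter> Z = {}}"
        then obtain S' where S': "S = S' - {z}" "S' \<in> ?B" "S \<inter> Z = {}"
          by (auto simp: colon_def)
        have "S' \<notin> pairs (insert z Z)"
        proof
          assume "S' \<in> pairs (insert z Z)"
          then obtain u v where "S' = {u, v}" "u \<in> insert z Z" "v \<in> insert z Z" "u \<noteq> v"
            unfolding pairs_def by blast
          then have "u \<in> S \<inter> Z \<or> v \<in> S \<inter> Z"
            using S'(1) by auto
          then show False using S'(3) by blast
        qed
        then have "S' \<in> A" using S'(2) by blast
        then show "S \<in> A"
          using insert.prems[of S'] S'(1) by (simp add: Diff_triv)
      next
        fix S assume S: "S \<in> A"
        then have "S \<inter> insert z Z = {}" by (rule insert.prems)
        then have "S = S - {z}" "S \<inter> Z = {}" by auto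
        then show "S \<in> {S \<in> colon ?B {z}. S \<inter> Z = {}}"
          using S unfolding colon_def by blast
      qed
      then show "reg_le K {S \<in> colon ?B {z}. S \<inter> Z = {}} c"
        using assms(1) by simp
      show "{x} \<in> colon ?B {z}" if "x \<in> Z" for x
      proof -
        have "{z, x} \<in> ?B" "{z, x} - {z} = {x}"
          using that insert.hyps by (auto simp: pairs_def)
        then show ?thesis unfolding colon_def by (metis imageI)
      qed
    qed (use assms(2) in auto)
    show ?case
      by (rule reg_le_colon[OF 1 2]) (use assms(3) in \<open>simp add: one_ereal_def\<close>)
  qed
qed

section \<open>3-path ideals and pendant leaves\<close>

lemma path_sets_card: "S \<in> path_sets H \<Longrightarrow> card S = 3"
  by (auto simp: path_sets_def is_3path_def)

lemma path_sets_antichain: "S \<in> path_sets H \<Longrightarrow> T \<in> path_sets H \<Longrightarrow> S \<subseteq> (T :: 'v::finite set) \<Longrightarrow> S = T"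
  by (simp add: card_subset_eq path_sets_card)

lemma empty_not_path_set: "{} \<notin> path_sets H"
  using path_sets_card[of "{}" H] by auto

text \<open>The assumption \<open>1 \<le> b\<close> covers the convention for the zero
  ideal.\<close>

lemma reg_path_ideal3_le:
  assumes "reg_le TYPE('k::field) (path_sets H) b" and "1 \<le> b"
  shows "reg (path_ideal3 H :: ('v::finite, 'k) mpoly set) \<le> b"
  using assms by (auto simp: reg_def path_ideal3_eq reg_le_def intro!: Sup_least)

lemma reg_le_path_ideal3:
  "reg_le TYPE('k::field) (path_sets H) (reg (path_ideal3 H :: ('v::finite, 'k) mpoly set))"
proof (cases "path_sets H = {}")
  case True
  then show ?thesis by (simp add: reg_le_empty)
next
  case False
  then show ?thesis
    by (auto simp: reg_le_def reg_def path_ideal3_eq sqf_eq_zero_iff intro!: Sup_upper)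
qed

lemma reg_path_ideal3_ge_3:
  assumes "path_sets H \<noteq> {}"
  shows "3 \<le> reg (path_ideal3 H :: ('v::finite, 'k::field) mpoly set)"
proof -
  obtain T where T: "T \<in> path_sets H" using assms by blast
  then have "ereal (card T) \<le> reg (path_ideal3 H :: ('v, 'k) mpoly set)"
    by (intro card_le_reg_le[OF reg_le_path_ideal3] path_sets_antichain)
  then show ?thesis
    using path_sets_card[OF T] by simp
qed

lemma reg_path_ideal3_ge_1: "1 \<le> reg (path_ideal3 H :: ('v::finite, 'k::field) mpoly set)"
proof (cases "path_sets H = {}")
  case True
  then show ?thesis by (simp add: reg_def path_ideal3_eq sqf_empty)
next
  case False
  have "(1 :: ereal) \<le> 3" by simp
  then show ?thesis
    using reg_path_ideal3_ge_3[OF False] by (rule order_trans)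
qed

section \<open>Combinatorics of 3-paths and induced subgraphs\<close>

lemma adjacent_sym: "adjacent G x y \<longleftrightarrow> adjacent G y x"
  by (simp add: adjacent_def insert_commute)

lemma adjacent_irrefl: "simple_graph G \<Longrightarrow> \<not> adjacent G x x"
  by (fastforce simp: simple_graph_def adjacent_def)

lemma path_sets_delete_verts:
  assumes "verts G = UNIV"
  shows "path_sets (delete_verts G U) = {S \<in> path_sets G. S \<inter> U = {}}"
proof -
  have *: "is_3path (delete_verts G U) x y z \<longleftrightarrow> is_3path G x y z \<and> {x, y, z} \<inter> U = {}" for x y z
    using assms by (auto simp: is_3path_def delete_verts_def induced_def adjacent_def)
  show ?thesis
    unfolding path_sets_def * by blast
qed

text \<open>A 3-path is connected, so it cannot leave a set that it meets and that is closed under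
  neighbours on the path.\<close>

lemma path_sets_subset_closed:
  assumes "S \<in> path_sets G" and "S \<inter> C \<noteq> {}"
    and "\<And>a b. a \<in> C \<Longrightarrow> b \<in> S \<Longrightarrow> adjacent G a b \<Longrightarrow> b \<in> C"
  shows "S \<subseteq> C"
proof -
  obtain x y z where S: "S = {x, y, z}" "adjacent G x y" "adjacent G y z"
    using assms(1) by (auto simp: path_sets_def is_3path_def)
  have "adjacent G y x" "adjacent G z y"
    using S(2,3) adjacent_sym by metis+
  then have adj: "y \<in> S" "adjacent G x y" "x \<in> S" "adjacent G y x" "z \<in> S" "adjacent G y z" "adjacent G z y"
    using S by simp_all
  have "x \<in> C \<Longrightarrow> y \<in> C" "z \<in> C \<Longrightarrow> y \<in> C"
    by (rule assms(3)[OF _ adj(1,2)], assumption) (rule assms(3)[OF _ adj(1,7)], assumption)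
  moreover have "y \<in> C \<Longrightarrow> x \<in> C" "y \<in> C \<Longrightarrow> z \<in> C"
    by (rule assms(3)[OF _ adj(3,4)], assumption) (rule assms(3)[OF _ adj(5,6)], assumption)
  ultimately show ?thesis
    using assms(2) unfolding S(1) by blast
qed

lemma path_set_insert_2: "S \<in> path_sets G \<Longrightarrow> \<not> S \<subseteq> {x, y}"
  using card_mono[of "{x, y}" S] path_sets_card[of S G] card_insert_le_m1[of 2 "{y}" x]
  by (auto simp: card_insert_if split: if_splits)

text \<open>Restricting to \<open>T\<close> and the complement of \<open>U\<close> isolates the
  generator \<open>T\<close>, since all neighbours of \<open>T\<close> lie in \<open>U\<close>. A
  disjoint generator of degree 3 raises the regularity by \<open>3 - 1 = 2\<close>.\<close>

lemma reg_path_ideal3_disjoint_path: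
  fixes G :: "'v::finite graph"
  assumes "verts G = UNIV" and "T \<in> path_sets G" and "T \<subseteq> U"
    and "\<And>a. a \<in> T \<Longrightarrow> nbhd G a \<subseteq> U"
  shows "reg (path_ideal3 (delete_verts G U) :: ('v, 'k::field) mpoly set) + 2
    \<le> reg (path_ideal3 G :: ('v, 'k) mpoly set)"
proof -
  let ?P = "path_sets (delete_verts G U)" and ?b = "reg (path_ideal3 G :: ('v, 'k) mpoly set)"
  have P: "?P = {S \<in> path_sets G. S \<inter> U = {}}"
    using assms(1) by (rule path_sets_delete_verts)
  have "insert T ?P = {S \<in> path_sets G. S \<subseteq> T \<union> - U}"
  proof (intro equalityI subsetI)
    fix S assume S: "S \<in> {S \<in> path_sets G. S \<subseteq> T \<union> - U}"
    show "S \<in> insert T ?P"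
    proof (cases "S \<inter> T = {}")
      case True
      then show ?thesis using S P by auto
    next
      case False
      have "S \<subseteq> T"
        by (rule path_sets_subset_closed[of _ G]) (use S False assms(4) in \<open>auto simp: nbhd_def\<close>)
      then show ?thesis
        using S assms(2) path_sets_antichain by blast
    qed
  qed (use assms(2,3) P in auto)
  then have "reg_le TYPE('k) (insert T ?P) ?b"
    by (rule reg_le_restrict[OF reg_le_path_ideal3])
  moreover have "T \<noteq> {}" using assms(2) empty_not_path_set by blast
  moreover have "S \<inter> T = {}" if "S \<in> ?P" for S
    using that P assms(3) by auto
  ultimately have "reg_le TYPE('k) ?P (?b - ereal (real (card T) - 1))"
    using empty_not_path_set by (rule reg_le_insert_disjoint)
  moreover have "card T = 3" using assms(2) by (rule path_sets_card)
  ultimately have *: "reg_le TYPE('k) ?P (?b - 2)" by simp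
  \<comment> \<open>Needed for the zero ideal convention: the bound \<open>?b - 2\<close> must still
    be at least 1.\<close>
  have "3 \<le> ?b" using assms(2) reg_path_ideal3_ge_3 by blast
  then have "1 \<le> ?b - 2"
    by (cases ?b) (auto simp: one_ereal_def)
  then have "reg (path_ideal3 (delete_verts G U) :: ('v, 'k) mpoly set) \<le> ?b - 2"
    by (rule reg_path_ideal3_le[OF *])
  then show ?thesis
    by (simp add: ereal_le_minus)
qed

lemma reg_path_ideal3_delete_verts:
  fixes G :: "'v::finite graph"
  assumes "verts G = UNIV"
  shows "reg (path_ideal3 (delete_verts G U) :: ('v, 'k::field) mpoly set)
    \<le> reg (path_ideal3 G :: ('v, 'k) mpoly set)"
proof (rule reg_path_ideal3_le[OF reg_le_restrict[OF reg_le_path_ideal3] reg_path_ideal3_ge_1])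
  show "path_sets (delete_verts G U) = {S \<in> path_sets G. S \<subseteq> - U}"
    unfolding path_sets_delete_verts[OF assms] by auto
qed

section \<open>The local configuration: a vertex \<open>y\<close> with leaf neighbours
  \<open>Z\<close> and one further neighbour \<open>x\<close>\<close>

context
  fixes G :: "'v::finite graph" and Z :: "'v set" and y x :: 'v
  assumes simple: "simple_graph G" and verts: "verts G = UNIV"
    and nbhd_y: "nbhd G y = insert x Z" and x_Z: "x \<notin> Z"
    and nbhd_Z: "\<And>z. z \<in> Z \<Longrightarrow> nbhd G z = {y}"
begin

abbreviation (input) "del_leaves \<equiv> delete_verts G Z"
abbreviation (input) "del_y \<equiv> delete_verts G (closed_nbhd G {y})"
abbreviation (input) "del_yx \<equiv> delete_verts G (closed_nbhd G {y, x})"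

lemma closed_nbhd_y: "closed_nbhd G {y} = insert y (insert x Z)"
  by (simp add: closed_nbhd_def nbhd_y)

lemma closed_nbhd_yx: "closed_nbhd G {y, x} = insert y (insert x (Z \<union> nbhd G x))"
  by (auto simp: closed_nbhd_def nbhd_y)

lemma y_neq: "y \<noteq> x" "y \<notin> Z"
  using nbhd_y adjacent_irrefl[OF simple, of y] by (auto simp: nbhd_def)

lemma adj_iff: "adjacent G y a \<longleftrightarrow> a = x \<or> a \<in> Z" "z \<in> Z \<Longrightarrow> adjacent G z a \<longleftrightarrow> a = y"
  using nbhd_y nbhd_Z[of z] by (auto simp: nbhd_def)

lemma x_nbhd: "y \<in> nbhd G x" "x \<notin> nbhd G x" "z \<in> Z \<Longrightarrow> z \<notin> nbhd G x"
  using adj_iff adjacent_irrefl[OF simple] adjacent_sym[of G x] y_neq by (auto simp: nbhd_def)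

lemma path_setsI: "distinct [a, b, c] \<Longrightarrow> adjacent G a b \<Longrightarrow> adjacent G b c \<Longrightarrow> {a, b, c} \<in> path_sets G"
  using verts unfolding path_sets_def is_3path_def by blast

lemma three_paths:
  "z \<in> Z \<Longrightarrow> {z, y, x} \<in> path_sets G"
  "z \<in> Z \<Longrightarrow> z' \<in> Z \<Longrightarrow> z \<noteq> z' \<Longrightarrow> {z, y, z'} \<in> path_sets G"
  "w \<in> nbhd G x \<Longrightarrow> w \<noteq> y \<Longrightarrow> {y, x, w} \<in> path_sets G"
  by (rule path_setsI; use x_Z y_neq adj_iff x_nbhd in \<open>auto simp: nbhd_def\<close>)+

text \<open>The only neighbour of a leaf in \<open>Z\<close> is \<open>y\<close>, so a path missing
  \<open>y\<close> would be confined to a single vertex.\<close>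

lemma path_set_Z: "S \<in> path_sets G \<Longrightarrow> z \<in> S \<Longrightarrow> z \<in> Z \<Longrightarrow> y \<in> S"
  using path_sets_subset_closed[of S G "{z}"] path_set_insert_2[of S G z z] adj_iff(2)[of z]
  by auto

text \<open>Every neighbour of \<open>y\<close> or \<open>x\<close> other than these two is a variable of the colon ideal, so
  only the 3-paths far away from both survive.\<close>

lemma reg_le_colon_edge:
  assumes "reg_le K (path_sets del_yx) b" and "1 \<le> b" and A: "A = path_sets G \<and> V = Z \<or> A = path_sets del_leaves \<and> V = {}"
  shows "reg_le K (colon A {y, x}) b"
proof (rule reg_le_vars[where U = "V \<union> (nbhd G x - {y})"])
  \<comment> \<open>\<open>V\<close> records the leaves at \<open>y\<close> that are still present
    in \<open>A\<close>, so that \<open>G\<close> and \<open>G\<close> without its leaves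
    \<open>Z\<close> are treated together.\<close>
  let ?U = "V \<union> (nbhd G x - {y})"
  have AP: "A \<subseteq> path_sets G" and AV: "\<And>S. S \<in> A \<Longrightarrow> S \<inter> V = {} \<Longrightarrow> S \<inter> Z = {}"
    using A unfolding path_sets_delete_verts[OF verts] by auto
  have paths_del_yx: "path_sets del_yx = {S \<in> path_sets G. S \<inter> insert y (insert x (Z \<union> nbhd G x)) = {}}"
    unfolding path_sets_delete_verts[OF verts] closed_nbhd_yx ..
  have "{S \<in> colon A {y, x}. S \<inter> ?U = {}} = path_sets del_yx"
  proof (intro equalityI subsetI)
    fix S' assume "S' \<in> {S \<in> colon A {y, x}. S \<inter> ?U = {}}"
    then obtain S where S: "S' = S - {y, x}" "S \<in> A" "S' \<inter> ?U = {}"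
      by (auto simp: colon_def)
    have SV: "S \<inter> V = {}"
      using S A y_neq x_Z by auto
    have Sx: "S \<inter> nbhd G x \<subseteq> {y}"
      using S x_nbhd by auto
    have SZ: "S \<inter> Z = {}"
      using AV[OF S(2) SV] .
    have "S \<inter> {y, x} = {}"
    proof (rule ccontr)
      \<comment> \<open>With the other neighbours of \<open>y\<close> and \<open>x\<close> excluded,
        \<open>{y, x}\<close> is closed for the path, but it is too small to contain three
        vertices.\<close>
      assume meets: "S \<inter> {y, x} \<noteq> {}"
      have "b \<in> {y, x}" if "a \<in> {y, x}" "b \<in> S" "adjacent G a b" for a b
        using that(1)
      proof
        assume "a = y"
        then show ?thesis using that adj_iff(1)[of b] SZ by auto
      next
        assume "a \<in> {x}"
        then show ?thesis using that Sx by (auto simp: nbhd_def)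
      qed
      then have "S \<subseteq> {y, x}"
        using S(2) AP meets by (intro path_sets_subset_closed[of S G]) auto
      then show False
        using path_set_insert_2[of S G y x] S(2) AP by auto
    qed
    then show "S' \<in> path_sets del_yx"
      using S(1,2) Sx SZ AP unfolding paths_del_yx by (auto simp: Diff_triv)
  next
    fix S assume S: "S \<in> path_sets del_yx"
    then have "S - {y, x} = S" "S \<inter> ?U = {}" "S \<in> A"
      using A unfolding path_sets_delete_verts[OF verts] closed_nbhd_yx by auto
    then show "S \<in> {S \<in> colon A {y, x}. S \<inter> ?U = {}}"
      unfolding colon_def by (auto intro: image_eqI[of S "\<lambda>S. S - {y, x}" S])
  qed
  then show "reg_le K {S \<in> colon A {y, x}. S \<inter> ?U = {}} b"
    using assms(1) by simp
  show "{w} \<in> colon A {y, x}" if w: "w \<in> ?U" for w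
  proof (cases "w \<in> V")
    case True
    then have "{w, y, x} \<in> A" "{w, y, x} - {y, x} = {w}"
      using A three_paths(1) x_Z y_neq by auto
    then show ?thesis unfolding colon_def by (metis imageI)
  next
    case False
    then have "{y, x, w} \<in> path_sets G" "{y, x, w} \<inter> Z = {}"
      using w three_paths(3) x_Z y_neq x_nbhd by auto
    then have "{y, x, w} \<in> A"
      using A unfolding path_sets_delete_verts[OF verts] by auto
    moreover have "{y, x, w} - {y, x} = {w}"
      using w False x_nbhd by auto
    ultimately show ?thesis unfolding colon_def by (metis imageI)
  qed
qed (use assms(2) in simp)

text \<open>Once \<open>y\<close> is a variable of the ideal, \<open>path_set_Z\<close> eliminates
  every path through a leaf in \<open>Z\<close>; what remains is a restriction of the ideal of
  \<open>del_leaves\<close>.\<close>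

lemma reg_le_delete_y:
  assumes "reg_le K (path_sets del_leaves) b" and "1 \<le> b"
  shows "reg_le K (insert {y} (path_sets G)) b"
proof (rule reg_le_vars[where U = "{y}"])
  have "{S \<in> insert {y} (path_sets G). S \<inter> {y} = {}} = {S \<in> path_sets del_leaves. S \<subseteq> - {y}}"
    unfolding path_sets_delete_verts[OF verts] using path_set_Z by auto
  then show "reg_le K {S \<in> insert {y} (path_sets G). S \<inter> {y} = {}} b"
    by (rule reg_le_restrict[OF assms(1)])
qed (use assms(2) in auto)

text \<open>Split the colon ideal at \<open>x\<close>. Adding \<open>x\<close> leaves the paths of
  \<open>del_y\<close> and, from the paths through \<open>y\<close> and two leaves, the pairs in
  \<open>Z\<close>; the colon by \<open>x\<close> is the colon by the edge.\<close>

lemma reg_le_colon_y: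
  assumes "reg_le K (path_sets del_y) c" and "1 \<le> c" and "c + 1 \<le> b"
  shows "reg_le K (colon (path_sets G) {y}) b"
proof (rule reg_le_colon[where T = "{x}"])
  let ?Q = "colon (path_sets G) {y}"
  have paths_del_y: "path_sets del_y = {S \<in> path_sets G. S \<inter> insert y (insert x Z) = {}}"
    unfolding path_sets_delete_verts[OF verts] closed_nbhd_y ..
  have cb: "c \<le> b"
    using assms(3) by (cases c; cases b) (auto simp: one_ereal_def)
  show "reg_le K (insert {x} ?Q) b"
  proof (rule reg_le_vars[where U = "{x}"])
    have "{S \<in> insert {x} ?Q. S \<inter> {x} = {}} = path_sets del_y \<union> pairs Z"
    proof (intro equalityI subsetI)
      fix S' assume "S' \<in> {S \<in> insert {x} ?Q. S \<inter> {x} = {}}"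
      then obtain S where S: "S' = S - {y}" "S \<in> path_sets G" "x \<notin> S"
        using y_neq by (auto simp: colon_def)
      show "S' \<in> path_sets del_y \<union> pairs Z"
      proof (cases "y \<in> S")
        case False
        then show ?thesis
          using S path_set_Z unfolding paths_del_y by auto
      next
        case True
        \<comment> \<open>A path through \<open>y\<close> that avoids \<open>x\<close> can only use
          leaves, so removing \<open>y\<close> leaves two of them.\<close>
        have "S \<subseteq> insert y Z"
          by (rule path_sets_subset_closed[OF S(2)]) (use True S(3) adj_iff in auto)
        then have "S' \<subseteq> Z" using S(1) by auto
        moreover have "card S' = 2"
          using S True path_sets_card[OF S(2)] by simp
        ultimately show ?thesis
          unfolding pairs_def card_2_iff by blast
      qed
    next
      fix S assume "S \<in> path_sets del_y \<union> pairs Z"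
      then show "S \<in> {S \<in> insert {x} ?Q. S \<inter> {x} = {}}"
      proof
        assume "S \<in> path_sets del_y"
        then have "S \<in> path_sets G" "S - {y} = S" "x \<notin> S"
          unfolding paths_del_y by auto
        then show ?thesis
          unfolding colon_def by (auto intro: image_eqI[of S "\<lambda>S. S - {y}" S])
      next
        assume "S \<in> pairs Z"
        then obtain u v where S: "S = {u, v}" "u \<in> Z" "v \<in> Z" "u \<noteq> v"
          by (auto simp: pairs_def)
        then have "{u, y, v} \<in> path_sets G" "S = {u, y, v} - {y}" "S \<inter> {x} = {}"
          using three_paths(2) y_neq x_Z by auto
        then show ?thesis
          unfolding colon_def by blast
      qed
    qed
    moreover have "reg_le K (path_sets del_y \<union> pairs Z) b"
      by (rule reg_le_pairs[OF assms]) (auto simp: paths_del_y)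
    ultimately show "reg_le K {S \<in> insert {x} ?Q. S \<inter> {x} = {}} b"
      by simp
  qed (use assms(2) cb in auto)
  \<comment> \<open>\<open>del_yx\<close> is an induced subgraph of \<open>del_y\<close> and
    inherits its bound.\<close>
  have "path_sets del_yx = {S \<in> path_sets del_y. S \<subseteq> - nbhd G x}"
    unfolding path_sets_delete_verts[OF verts] closed_nbhd_yx closed_nbhd_y by auto
  then have "reg_le K (path_sets del_yx) c"
    by (rule reg_le_restrict[OF assms(1)])
  then have "reg_le K (colon (path_sets G) {y, x}) c"
    using assms(2) by (rule reg_le_colon_edge[where V = Z]) simp
  moreover have "colon ?Q {x} = colon (path_sets G) {y, x}"
    by (simp add: colon_def image_image Diff_insert2[symmetric])
  ultimately show "reg_le K (colon ?Q {x}) c" by simp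
qed (use assms(3) in \<open>simp add: one_ereal_def\<close>)

text \<open>The upper bound splits at \<open>y\<close>. For the lower bound, the path
  \<open>z, y, z'\<close> has all its neighbours in the closed neighbourhood of \<open>y\<close>, so
  it is disjoint from \<open>del_y\<close>.\<close>

lemma reg_two_leaves:
  assumes "z \<in> Z" "z' \<in> Z" "z \<noteq> z'"
  shows "reg (path_ideal3 G :: ('v, 'k::field) mpoly set) =
    max (reg (path_ideal3 del_leaves :: ('v, 'k) mpoly set)) (reg (path_ideal3 del_y :: ('v, 'k) mpoly set) + 2)"
    (is "_ = max ?r1 (?r2 + 2)")
proof (rule antisym)
  let ?b = "max ?r1 (?r2 + 2)"
  have 1: "1 \<le> ?b"
    using reg_path_ideal3_ge_1 by (rule max.coboundedI1)
  have c: "1 \<le> ?r2" by (rule reg_path_ideal3_ge_1)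
  have r1: "reg_le TYPE('k) (path_sets del_leaves) ?b"
    by (rule reg_le_mono[OF reg_le_path_ideal3]) simp
  have eq: "?r2 + 1 + ereal (card {y}) = ?r2 + 2"
    by (simp add: one_ereal_def add.assoc)
  have "reg_le TYPE('k) (path_sets G) ?b"
    by (rule reg_le_colon[OF reg_le_delete_y[OF r1 1] reg_le_colon_y[OF reg_le_path_ideal3 c order_refl]])
      (simp only: eq max.cobounded2)
  then show "reg (path_ideal3 G :: ('v, 'k) mpoly set) \<le> ?b"
    using 1 by (rule reg_path_ideal3_le)
  have "?r2 + 2 \<le> reg (path_ideal3 G :: ('v, 'k) mpoly set)"
    using assms verts three_paths(2)
    by (intro reg_path_ideal3_disjoint_path[where T = "{z, y, z'}"]) (auto simp: closed_nbhd_y nbhd_y nbhd_Z)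
  then show "?b \<le> reg (path_ideal3 G :: ('v, 'k) mpoly set)"
    using reg_path_ideal3_delete_verts[OF verts] by simp
qed

text \<open>Adding the edge \<open>yx\<close> to the ideals of \<open>G\<close> and of \<open>G \<setminus> z\<close> gives the same ideal, and so do the
  colon ideals with respect to this edge up to the variable \<open>z\<close>.\<close>

lemma reg_one_leaf:
  assumes Z: "Z = {z}"
  shows "reg (path_ideal3 G :: ('v, 'k::field) mpoly set) =
    max (reg (path_ideal3 del_leaves :: ('v, 'k) mpoly set)) (reg (path_ideal3 del_yx :: ('v, 'k) mpoly set) + 2)"
    (is "_ = max ?r1 (?r3 + 2)")
proof (rule antisym)
  let ?b = "max ?r1 (?r3 + 2)"
  have 1: "1 \<le> ?b"
    using reg_path_ideal3_ge_1 by (rule max.coboundedI1)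
  have c: "1 \<le> ?r3" by (rule reg_path_ideal3_ge_1)
  then have "1 + 2 \<le> ?r3 + 2" by (rule add_right_mono)
  then have "(2 :: ereal) \<le> ?r3 + 2"
    by (rule order_trans[rotated]) simp
  then have 2: "(2 :: ereal) \<le> ?b" by (rule max.coboundedI2)
  have "?r3 + 1 \<le> ?r3 + 2"
    by (rule add_left_mono) simp
  then have c1: "?r3 + 1 \<le> ?b" by (rule max.coboundedI2)
  have card: "card {y, x} = 2" using y_neq by simp
  have r1: "reg_le TYPE('k) (path_sets del_leaves) ?b"
    by (rule reg_le_mono[OF reg_le_path_ideal3]) simp
  \<comment> \<open>The edge has degree 2, so inserting it costs only \<open>?r3 + 1\<close>; the
    later colon step costs \<open>?r3 + 2\<close>.\<close>
  have "reg_le TYPE('k) (insert {y, x} (path_sets del_leaves)) ?b"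
    using reg_le_insert[OF r1 reg_le_colon_edge[OF reg_le_path_ideal3 c], of "{}"] c1 2 card
    by (simp add: one_ereal_def)
  moreover have "sqf (insert {y, x} (path_sets G)) = (sqf (insert {y, x} (path_sets del_leaves)) :: ('v, 'k) mpoly set)"
  proof (rule sqf_cong)
    fix S assume S: "S \<in> insert {y, x} (path_sets G)"
    show "\<exists>S'\<in>insert {y, x} (path_sets del_leaves). S' \<subseteq> S"
    proof (cases "S \<in> path_sets G \<and> z \<in> S")
      case True
      \<comment> \<open>A path through the only leaf \<open>z\<close> must contain \<open>y\<close>
        and \<open>x\<close>, so it is a multiple of the added edge. Without \<open>x\<close> it
        would stay inside \<open>{y, z}\<close>.\<close>
      have "x \<in> S"
      proof (rule ccontr)
        assume "x \<notin> S"
        then have "S \<subseteq> {y, z}"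
          using True adj_iff Z by (intro path_sets_subset_closed[of S G]) auto
        then show False using path_set_insert_2[of S G y z] True by simp
      qed
      then show ?thesis
        using True path_set_Z[of S z] Z by auto
    next
      case False
      then have "S \<in> insert {y, x} (path_sets del_leaves)"
        using S Z unfolding path_sets_delete_verts[OF verts] by auto
      then show ?thesis by blast
    qed
  qed (auto simp: path_sets_delete_verts[OF verts])
  ultimately have "reg_le TYPE('k) (insert {y, x} (path_sets G)) ?b"
    by (simp only: reg_le_def)
  then have "reg_le TYPE('k) (path_sets G) ?b"
    by (rule reg_le_colon[OF _ reg_le_colon_edge[OF reg_le_path_ideal3 c, where V = Z]]) (simp_all add: card)
  then show "reg (path_ideal3 G :: ('v, 'k) mpoly set) \<le> ?b"
    using 1 by (rule reg_path_ideal3_le)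
  \<comment> \<open>The path \<open>z, y, x\<close> and all its neighbours lie in the closed
    neighbourhood of \<open>{y, x}\<close>.\<close>
  have "?r3 + 2 \<le> reg (path_ideal3 G :: ('v, 'k) mpoly set)"
    using Z verts three_paths(1)
    by (intro reg_path_ideal3_disjoint_path[where T = "{z, y, x}"]) (auto simp: closed_nbhd_yx nbhd_y nbhd_Z)
  then show "?b \<le> reg (path_ideal3 G :: ('v, 'k) mpoly set)"
    using reg_path_ideal3_delete_verts[OF verts] by simp
qed

end

section \<open>From levels in the rooted tree to the local configuration\<close>

lemma successively_closed:
  assumes "successively R p" and "p \<noteq> []" and "hd p \<in> C" and "\<And>a b. a \<in> C \<Longrightarrow> R a b \<Longrightarrow> b \<in> C"
  shows "set p \<subseteq> C"
  using assms(1-3) by (induction p rule: induct_list012) (auto dest: assms(4))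

text \<open>On at most two vertices the path between given endpoints is unique and has at most two
  entries; this evaluates the definite description in \<open>level\<close>. The vertices
  \<open>a\<close> and \<open>b\<close> may coincide.\<close>

lemma is_path_two_vertices:
  fixes G :: "'v graph" and a b :: 'v
  assumes "is_path G u p w" and "UNIV \<subseteq> {a, b}"
  shows "p = (if u = w then [u] else [u, w])"
proof -
  have p: "p \<noteq> []" "hd p = u" "last p = w" "distinct p"
    using assms(1) by (auto simp: is_path_def)
  have "length p = card (set p)"
    using p(4) by (simp add: distinct_card)
  also have "\<dots> \<le> card {a, b}"
    by (rule card_mono) (use assms(2) in auto)
  also have "\<dots> \<le> 2"
    by (simp add: card_insert_if)
  finally have "length p \<le> 2" .
  then consider a where "p = [a]" | a b where "p = [a, b]"
    using p(1) by (cases p; cases "tl p") auto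
  then show ?thesis
    by cases (use p in auto)
qed

theorem theorem4p4:
  fixes G :: "'v::finite graph"
    and vs :: "'v list" and r :: nat
    and z :: "nat \<Rightarrow> 'v" and s :: nat and y0 x0 :: 'v
    and T G1 G2 G3 :: "'v graph" and lev :: "'v \<Rightarrow> nat"
  assumes "T = attached_tree G vs (vs ! r)"
    and "lev = level T (vs ! r)"
    and "G1 = delete_verts G (z ` {..s})"
    and "G2 = delete_verts G (closed_nbhd G {y0})"
    and "G3 = delete_verts G (closed_nbhd G {y0, x0})"
    and "simple_graph G" and "verts G = UNIV"
    and "connected_graph G" and "at_most_one_cycle G"
    and "root_list G vs" and "r < length vs"
    and "z 0 \<in> verts T" and "leaf G (z 0)"
    and "\<forall>w\<in>verts T. leaf G w \<longrightarrow> lev w \<le> lev (z 0)"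
    and "lev (z 0) \<ge> 2"
    and "nbhd G (z 0) = {y0}"
    and "nbhd G y0 = z ` {..s} \<union> {x0}" and "inj_on z {..s}"
    and "\<forall>i\<le>s. leaf G (z i) \<and> lev (z i) = lev (z 0)"
    and "\<forall>x\<in>nbhd G y0. lev x < lev y0 \<longleftrightarrow> x = x0"
  shows "reg (path_ideal3 G :: ('v, 'k::field) mpoly set) =
    (if s \<ge> 1
     then max (reg (path_ideal3 G1 :: ('v, 'k) mpoly set))
              (reg (path_ideal3 G2 :: ('v, 'k) mpoly set) + 2)
     else max (reg (path_ideal3 G1 :: ('v, 'k) mpoly set))
              (reg (path_ideal3 G3 :: ('v, 'k) mpoly set) + 2))"
proof -
  let ?Z = "z ` {..s}"
  have levz: "lev (z i) = lev (z 0)" and leafz: "leaf G (z i)" if "i \<le> s" for i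
    using assms(19) that by blast+
  have x0: "x0 \<notin> ?Z"
  proof
    \<comment> \<open>Otherwise \<open>G\<close> is a single edge, and all levels are at most 1.\<close>
    assume "x0 \<in> ?Z"
    then obtain k where k: "k \<le> s" "x0 = z k" by auto
    have "x0 \<in> nbhd G y0" "z 0 \<in> nbhd G y0"
      using assms(17) by auto
    moreover have "lev x0 = lev (z 0)"
      using levz[OF k(1)] k(2) by simp
    \<comment> \<open>The neighbour \<open>x0\<close> lies below \<open>y0\<close>, hence so does
      \<open>z 0\<close>, which has the same level; only \<open>x0\<close> among the neighbours
      does.\<close>
    ultimately have z0: "z 0 = x0"
      using assms(20) by metis
    have "z i = x0" if "i \<le> s" for i
    proof -
      have "z i \<in> nbhd G y0" using assms(17) that by auto
      moreover have "lev (z i) = lev x0" using levz[OF that] z0 by simp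
      ultimately show ?thesis using assms(20) \<open>x0 \<in> nbhd G y0\<close> by metis
    qed
    then have nb: "nbhd G y0 = {z 0}"
      using assms(17) z0 by auto
    \<comment> \<open>\<open>y0\<close> and \<open>z 0\<close> have only each other as neighbours,
      so by connectedness there are no further vertices.\<close>
    have two: "UNIV \<subseteq> {z 0, y0}"
    proof
      fix w :: 'v
      have "\<exists>p. is_path G (z 0) p w"
        using assms(7,8) by (simp add: connected_graph_def)
      then obtain p where p: "is_path G (z 0) p w" ..
      have "set p \<subseteq> {z 0, y0}"
        by (rule successively_closed[of "adjacent G"])
          (use p nb assms(16) in \<open>auto simp: is_path_def nbhd_def\<close>)
      then show "w \<in> {z 0, y0}"
        using p by (auto simp: is_path_def dest: last_in_set)
    qed
    have "\<not> is_cycle G ws" for ws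
    proof
      assume ws: "is_cycle G ws"
      then have "3 \<le> card (set ws)"
        by (simp add: is_cycle_def distinct_card)
      also have "\<dots> \<le> card {z 0, y0}"
        by (rule card_mono) (use two in auto)
      also have "\<dots> \<le> 2" by (simp add: card_insert_if)
      finally show False by simp
    qed
    then obtain v where vs: "vs = [v]"
      using assms(10) by (auto simp: root_list_def)
    \<comment> \<open>For a single root \<open>cycle_edges vs\<close> is \<open>{{v}}\<close>;
      removing it changes nothing, so the attached tree is all of \<open>G\<close>.\<close>
    have "{v} \<notin> edges G"
      using assms(6) by (fastforce simp: simple_graph_def)
    then have "edges G - cycle_edges vs = edges G"
      by (auto simp: cycle_edges_def vs)
    then have "T = component G v"
      using assms(1,11) by (simp add: attached_tree_def vs)
    also have "\<dots> = induced G UNIV"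
      using assms(7,8) by (simp add: component_def connected_graph_def)
    also have "\<dots> = G"
      by (simp add: induced_def)
    finally have T: "T = G" .
    have "\<exists>p. is_path G v p (z 0)"
      using assms(7,8) by (simp add: connected_graph_def)
    then obtain p where p: "is_path G v p (z 0)" ..
    have "is_path G v (THE p. is_path G v p (z 0)) (z 0)"
      using p by (rule theI) (use is_path_two_vertices[OF _ two] p in metis)
    from is_path_two_vertices[OF this two] have "length (THE p. is_path G v p (z 0)) \<le> 2"
      by (auto split: if_splits)
    then have "lev (z 0) \<le> 1"
      using assms(2,11) T by (simp add: level_def vs)
    then show False using assms(15) by simp
  qed
  have nbZ: "nbhd G w = {y0}" if "w \<in> ?Z" for w
  proof -
    have "y0 \<in> nbhd G w"
      using that assms(17) adjacent_sym[of G y0 w] by (auto simp: nbhd_def)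
    moreover have "card (nbhd G w) = 1"
      using that leafz by (auto simp: leaf_def)
    ultimately show ?thesis
      by (auto simp: card_1_singleton_iff)
  qed
  have nby: "nbhd G y0 = insert x0 ?Z"
    using assms(17) by auto
  show ?thesis
  proof (cases "s \<ge> 1")
    case True
    then have "z 0 \<in> ?Z" "z 1 \<in> ?Z" "z 0 \<noteq> z 1"
      using assms(18) by (auto simp: inj_on_def)
    from reg_two_leaves[OF assms(6,7) nby x0 nbZ this] True show ?thesis
      unfolding assms(3,4) by simp
  next
    case False
    then have "s = 0" by simp
    then have "?Z = {z 0}" by simp
    from reg_one_leaf[OF assms(6,7) nby x0 nbZ this] False show ?thesis
      unfolding assms(3,5) by simp
  qed
qed

end
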